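(* Let $G$ be a cactus with at least two blocks. Then, for the Maker-Breaker total domination game: (i) $G$ is ${\cal D}$ if and only if $V(G)$ can be partitioned into $4$-element sets each of which induces a cycle $C_4$; (ii) $G$ is ${\cal N}$ if and only if there exists a sequence of end-blocks isomorphic to $C_4$ such that iteratively removing them yields an ${\cal N}$-star cactus. Consequently, $G$ is ${\cal S}$ in all other cases.
   Context: All graphs are finite and simple. The Maker-Breaker total domination (MBTD) game on a graph $G$ is played by Dominator and Staller, who alternately select a vertex of $G$ not selected before. Dominator wins if at some point the set of vertices he has selected is a total dominating set of $G$ (every vertex of $G$ has a neighbour in it); otherwise Staller wins, equivalently if she selects all vertices of the open neighbourhood of some vertex. The D-game is the game where Dominator moves first, the S-game where Staller moves first. A graph is ${\cal D}$ if Dominator has a winning strategy in both games, ${\cal S}$ if Staller has a winning strategy in both, and ${\cal N}$ if the first player wins (Dominator wins the D-game and Staller wins the S-game); the empty graph is considered ${\cal D}$. A cactus is a connected graph each of whose blocks is a cycle or $K_2$. An end-block of a graph is a block intersecting the other blocks in at most one vertex. Removing an end-block $C$ isomorphic to $C_4$ means deleting all four vertices of $C$. A star cactus is a cactus containing a vertex that lies in every block. An ${\cal N}$-star cactus is a cactus $G$ such that either $G=C_3$, or $G$ is a star cactus with at least two blocks, all cycles of $G$ have length at most $5$, and $G$ contains a $3$-cycle, or a $4$-cycle, or two blocks isomorphic to $K_2$. *)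

theory Defs
  imports
    "Graph_Theory.Digraph_Isomorphism"
    "Graph_Theory.Kuratowski"
    "HOL-Library.Disjoint_Sets"
begin

text \<open>Finite simple graphs are the finite symmetric loop-free digraphs without parallel arcs
  of the locale \<^locale>\<open>graph\<close>: an edge is a pair of opposite arcs. The empty graph is allowed,
  but \<^const>\<open>connected\<close> graphs are nonempty.\<close>


section \<open>Cacti\<close>

definition std_cycle :: "nat \<Rightarrow> nat pair_pre_digraph" where
  "std_cycle n = \<lparr> pverts = {..<n},
     parcs = {(i, j). i < n \<and> j < n \<and> (j = Suc i mod n \<or> i = Suc j mod n)} \<rparr>"

definition cycle_graph :: "nat \<Rightarrow> ('a, 'b) pre_digraph \<Rightarrow> bool" where
  "cycle_graph n G \<longleftrightarrow> 3 \<le> n \<and> graph G \<and> digraph_iso G (with_proj (std_cycle n))"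

definition contains_cycle :: "('a, 'b) pre_digraph \<Rightarrow> nat \<Rightarrow> bool" where
  "contains_cycle G n \<longleftrightarrow> (\<exists>H. subgraph H G \<and> cycle_graph n H)"

text \<open>A cut vertex separates two vertices of the same component.\<close>

definition cut_vertex :: "('a, 'b) pre_digraph \<Rightarrow> 'a \<Rightarrow> bool" where
  "cut_vertex G v \<longleftrightarrow> v \<in> verts G \<and>
     (\<exists>x \<in> verts G - {v}. \<exists>y \<in> verts G - {v}.
        x \<rightarrow>\<^sup>*\<^bsub>G\<^esub> y \<and> \<not> x \<rightarrow>\<^sup>*\<^bsub>pre_digraph.del_vert G v\<^esub> y)"

definition nonseparable :: "('a, 'b) pre_digraph \<Rightarrow> bool" where
  "nonseparable G \<longleftrightarrow> graph G \<and> connected G \<and> \<not> (\<exists>v. cut_vertex G v)"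

definition block :: "('a, 'b) pre_digraph \<Rightarrow> ('a, 'b) pre_digraph \<Rightarrow> bool" where
  "block G B \<longleftrightarrow> pre_digraph.max_subgraph G nonseparable B"

definition cactus :: "('a, 'b) pre_digraph \<Rightarrow> bool" where
  "cactus G \<longleftrightarrow> graph G \<and> connected G \<and>
     (\<forall>B. block G B \<longrightarrow> (\<exists>n. cycle_graph n B) \<or> K\<^bsub>2\<^esub> B)"

definition star_cactus :: "('a, 'b) pre_digraph \<Rightarrow> bool" where
  "star_cactus G \<longleftrightarrow> cactus G \<and> (\<exists>c \<in> verts G. \<forall>B. block G B \<longrightarrow> c \<in> verts B)"

definition N_star_cactus :: "('a, 'b) pre_digraph \<Rightarrow> bool" where
  "N_star_cactus G \<longleftrightarrow> cactus G \<and>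
     (cycle_graph 3 G \<or>
      star_cactus G \<and> 2 \<le> card {B. block G B} \<and>
      (\<forall>n. contains_cycle G n \<longrightarrow> n \<le> 5) \<and>
      (contains_cycle G 3 \<or> contains_cycle G 4 \<or>
       (\<exists>B B'. block G B \<and> block G B' \<and> B \<noteq> B' \<and> K\<^bsub>2\<^esub> B \<and> K\<^bsub>2\<^esub> B')))"

definition end_block :: "('a, 'b) pre_digraph \<Rightarrow> ('a, 'b) pre_digraph \<Rightarrow> bool" where
  "end_block G B \<longleftrightarrow> block G B \<and>
     card (verts B \<inter> \<Union> {verts B' | B'. block G B' \<and> B' \<noteq> B}) \<le> 1"

text \<open>Removing the end-block deletes all four of its vertices, including the one it may share
  with other blocks, so the remaining graph can be disconnected.\<close>

definition remove_end_C4 :: "('a, 'b) pre_digraph \<Rightarrow> ('a, 'b) pre_digraph \<Rightarrow> bool" where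
  "remove_end_C4 G G' \<longleftrightarrow>
     (\<exists>B. end_block G B \<and> cycle_graph 4 B \<and> G' = G \<restriction> (verts G - verts B))"


section \<open>The Maker-Breaker total domination game\<close>

definition total_dominating_set :: "('a, 'b) pre_digraph \<Rightarrow> 'a set \<Rightarrow> bool" where
  "total_dominating_set G X \<longleftrightarrow> X \<subseteq> verts G \<and> (\<forall>v \<in> verts G. \<exists>u \<in> X. v \<rightarrow>\<^bsub>G\<^esub> u)"

datatype player = Dominator | Staller

fun opponent :: "player \<Rightarrow> player" where
  "opponent Dominator = Staller"
| "opponent Staller = Dominator"

text \<open>A position is the list of the vertices selected so far, in the order of selection. Below,
  \<open>p\<close> is the player who moves first.\<close>

definition position :: "('a, 'b) pre_digraph \<Rightarrow> 'a list \<Rightarrow> bool" where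
  "position G h \<longleftrightarrow> distinct h \<and> set h \<subseteq> verts G"

definition to_move :: "player \<Rightarrow> nat \<Rightarrow> player" where
  "to_move p i = (if even i then p else opponent p)"

definition selected :: "player \<Rightarrow> 'a list \<Rightarrow> player \<Rightarrow> 'a set" where
  "selected p h q = {h ! i | i. i < length h \<and> to_move p i = q}"

text \<open>Outcome of a play in which all vertices have been selected. Playing on after Dominator has
  already won does not affect the outcome.\<close>

definition dominator_wins_play :: "('a, 'b) pre_digraph \<Rightarrow> player \<Rightarrow> 'a list \<Rightarrow> bool" where
  "dominator_wins_play G p h \<longleftrightarrow>
     (\<exists>k \<le> length h. total_dominating_set G (selected p (take k h) Dominator))"

fun wins_play :: "('a, 'b) pre_digraph \<Rightarrow> player \<Rightarrow> player \<Rightarrow> 'a list \<Rightarrow> bool" where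
  "wins_play G p Dominator h \<longleftrightarrow> dominator_wins_play G p h"
| "wins_play G p Staller h \<longleftrightarrow> \<not> dominator_wins_play G p h"

definition follows :: "player \<Rightarrow> player \<Rightarrow> ('a list \<Rightarrow> 'a) \<Rightarrow> 'a list \<Rightarrow> bool" where
  "follows p q \<sigma> h \<longleftrightarrow> (\<forall>i < length h. to_move p i = q \<longrightarrow> h ! i = \<sigma> (take i h))"

definition winning_strategy ::
    "('a, 'b) pre_digraph \<Rightarrow> player \<Rightarrow> player \<Rightarrow> ('a list \<Rightarrow> 'a) \<Rightarrow> bool" where
  "winning_strategy G p q \<sigma> \<longleftrightarrow>
     (\<forall>h. position G h \<and> follows p q \<sigma> h \<and> set h \<noteq> verts G \<and> to_move p (length h) = q
        \<longrightarrow> \<sigma> h \<in> verts G - set h) \<and>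
     (\<forall>h. position G h \<and> follows p q \<sigma> h \<and> set h = verts G \<longrightarrow> wins_play G p q h)"

definition wins_game :: "('a, 'b) pre_digraph \<Rightarrow> player \<Rightarrow> player \<Rightarrow> bool" where
  "wins_game G p q \<longleftrightarrow> (\<exists>\<sigma>. winning_strategy G p q \<sigma>)"

definition graph_D :: "('a, 'b) pre_digraph \<Rightarrow> bool" where
  "graph_D G \<longleftrightarrow> wins_game G Dominator Dominator \<and> wins_game G Staller Dominator"

definition graph_S :: "('a, 'b) pre_digraph \<Rightarrow> bool" where
  "graph_S G \<longleftrightarrow> wins_game G Dominator Staller \<and> wins_game G Staller Staller"

definition graph_N :: "('a, 'b) pre_digraph \<Rightarrow> bool" where
  "graph_N G \<longleftrightarrow> wins_game G Dominator Dominator \<and> wins_game G Staller Staller"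

end

theory Submission
  imports Defs
begin

text \<open>Regard the game as the Maker-Breaker game on open neighbourhoods. If an end-block is a pendant
  \<open>K\<^sub>2\<close>, a \<open>C\<^sub>3\<close> or a cycle of length at least five, and Dominator owns none of its vertices, then
  Staller, on the move, wins inside it at once. If it is a \<open>C\<^sub>4\<close>, she takes the attaching
  vertex, Dominator must take the opposite one, and the game continues on the graph without that
  block. Repeating this, Dominator survives as second player only if the \<open>C\<^sub>4\<close> blocks exhaust the
  graph, and after a first move \<open>x\<close> only if the process ends in a graph all of whose blocks contain
  \<open>x\<close>, where the outcome is read off directly. Dominator's wins are all pairing strategies, and these
  extend over each removed \<open>C\<^sub>4\<close>.\<close>


section \<open>The game on a family of winning sets\<close>

text \<open>Why exactly the length 4 is exempt: on a cycle \<open>f 0, f 1, ...\<close> attached at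
  \<open>f 0\<close>, the vertices \<open>f 1\<close> and \<open>f 3\<close> have no neighbours
  elsewhere, so Staller's move \<open>f 2\<close> threatens \<open>f 0\<close> and
  \<open>f 4\<close> at once. From length 5 on these are two threats; in a 4-cycle they are the same
  vertex, and one answer meets both. The obstacle is that removing a 4-cycle also deletes its
  attaching vertex. The remaining graph may be disconnected and may have isolated vertices, so
  induction over cacti breaks down. Hence a hereditary class of graphs, and end-blocks that are
  found without a block tree: among the sets cut off from Dominator's vertices by a single vertex, a
  smallest one is, with that vertex, an end-block or a degenerate case that loses at once. Where no
  such set exists, Dominator's first vertex lies in every block. Dominator's side needs no descent
  on one point: opposite vertices of a 4-cycle form two pairs that dominate it, however the cycle
  sits in the graph.\<close>

text \<open>Dominator wins with \<open>q\<close> to move, when Staller owns \<open>S\<close>, the vertices of \<open>F\<close> are free, and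
  Staller wants to own a whole member of \<open>E\<close>.\<close>

inductive dwin :: "'a set set \<Rightarrow> player \<Rightarrow> 'a set \<Rightarrow> 'a set \<Rightarrow> bool" for E :: "'a set set" where
  final: "\<forall>e \<in> E. \<not> e \<subseteq> S \<Longrightarrow> dwin E q S {}"
| dominator: "x \<in> F \<Longrightarrow> dwin E Staller S (F - {x}) \<Longrightarrow> dwin E Dominator S F"
| staller: "F \<noteq> {} \<Longrightarrow> (\<And>x. x \<in> F \<Longrightarrow> dwin E Dominator (insert x S) (F - {x}))
    \<Longrightarrow> dwin E Staller S F"

lemma dwin_empty [simp]: "dwin E q S {} \<longleftrightarrow> (\<forall>e \<in> E. \<not> e \<subseteq> S)"
  by (auto elim: dwin.cases intro: dwin.final)

lemma dwin_Dominator_iff: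
  "F \<noteq> {} \<Longrightarrow> dwin E Dominator S F \<longleftrightarrow> (\<exists>x \<in> F. dwin E Staller S (F - {x}))"
  by (auto elim: dwin.cases intro: dwin.dominator)

lemma dwin_Staller_iff:
  "F \<noteq> {} \<Longrightarrow> dwin E Staller S F \<longleftrightarrow> (\<forall>x \<in> F. dwin E Dominator (insert x S) (F - {x}))"
  by (auto elim: dwin.cases intro: dwin.staller)

lemma dwin_not_claimed: "dwin E q S F \<Longrightarrow> e \<in> E \<Longrightarrow> \<not> e \<subseteq> S"
  by (induction rule: dwin.induct) auto

text \<open>A vertex that leaves \<open>F\<close> without entering \<open>S\<close> is a gift to
  Dominator. He keeps his strategy, and when it asks for the vertex he already holds, he plays any
  other free one.\<close>

lemma dwin_extra_vertex: "dwin E q S F \<Longrightarrow> x \<in> F \<Longrightarrow> dwin E q S (F - {x})"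
proof (induction arbitrary: x rule: dwin.induct)
  case (dominator y F S)
  show ?case
  proof (cases "x = y")
    case True
    show ?thesis
    proof (cases "F - {y} = {}")
      case True
      show ?thesis using dominator.hyps(2) unfolding \<open>x = y\<close> True by simp
    next
      case False
      then obtain z where z: "z \<in> F - {y}" by blast
      from dominator.IH[OF z] z show ?thesis unfolding \<open>x = y\<close> by (rule_tac dwin.dominator)
    qed
  next
    case False
    then have "dwin E Staller S (F - {y} - {x})" using dominator by blast
    then have "dwin E Staller S (F - {x} - {y})" by (simp add: Diff_insert2[symmetric] insert_commute)
    then show ?thesis using dominator.hyps(1) False by (intro dwin.dominator) auto
  qed
next
  case (staller F S)
  show ?case
  proof (cases "F - {x} = {}")
    case True
    with staller.prems have "F = {x}" by blast
    with staller.hyps(2)[OF staller.prems] have "\<forall>e \<in> E. \<not> e \<subseteq> insert x S" by simp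
    then show ?thesis unfolding True by auto
  next
    case False
    show ?thesis
    proof (rule dwin.staller[OF False])
      fix y assume "y \<in> F - {x}"
      then have "dwin E Dominator (insert y S) (F - {y} - {x})" using staller by blast
      then show "dwin E Dominator (insert y S) (F - {x} - {y})"
        by (simp add: Diff_insert2[symmetric] insert_commute)
    qed
  qed
qed auto

text \<open>Dominator spends the extra move on any free vertex, which can only help him.\<close>

lemma dwin_extra_move: "dwin E Staller S F \<Longrightarrow> dwin E Dominator S F"
proof (cases "F = {}")
  case False
  assume "dwin E Staller S F"
  then show ?thesis using False dwin_extra_vertex by (metis dwin_Dominator_iff ex_in_conv)
qed simp

lemma dwin_no_threat: "dwin E Staller S F \<Longrightarrow> x \<in> F \<Longrightarrow> e \<in> E \<Longrightarrow> \<not> e \<subseteq> insert x S"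
  by (metis dwin_Staller_iff dwin_not_claimed empty_iff)

text \<open>After \<open>x\<close> at most \<open>y\<close> is missing from \<open>e\<close>, so
  every answer other than \<open>y\<close> loses at once.\<close>

lemma dwin_forced:
  assumes "dwin E Staller S F" "x \<in> F" "y \<in> F" "x \<noteq> y" "e \<in> E" "e \<subseteq> insert y (insert x S)"
  shows "dwin E Staller (insert x S) (F - {x, y})"
proof -
  have "dwin E Dominator (insert x S) (F - {x})"
    using assms(1,2) dwin_Staller_iff[of F E S] by blast
  moreover have "F - {x} \<noteq> {}" using assms(3,4) by blast
  ultimately obtain z where z: "z \<in> F - {x}" "dwin E Staller (insert x S) (F - {x} - {z})"
    by (auto simp: dwin_Dominator_iff)
  have "z = y" using dwin_no_threat[OF z(2), of y e] assms by auto
  then show ?thesis using z by (simp add: Diff_insert2[symmetric] insert_commute)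
qed

text \<open>A fork: after \<open>x\<close> the threat to \<open>d\<close> forces Dominator to
  \<open>y\<close>, and Staller completes \<open>e\<close> with \<open>z\<close>.\<close>

lemma dwin_no_double_threat:
  assumes "dwin E Staller S F" "x \<in> F" "y \<in> F" "z \<in> F" "distinct [x, y, z]"
    and "d \<in> E" "d \<subseteq> insert y (insert x S)" "e \<in> E" "e \<subseteq> insert z (insert x S)"
  shows False
  using dwin_no_threat[OF dwin_forced[OF assms(1-3)], of d z e] assms by auto

text \<open>Whatever is missing of a new target covers what is missing of some old one, so Dominator
  copies his moves. This serves to take vertices away from Staller and to pass to the neighbourhoods
  of a smaller graph.\<close>

lemma dwin_mono:
  assumes "dwin E q S F" "\<And>e'. e' \<in> E' \<Longrightarrow> \<exists>e \<in> E. e - S \<subseteq> e' - S'"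
  shows "dwin E' q S' F"
  using assms
proof (induction arbitrary: S' rule: dwin.induct)
  case (final S q)
  have "\<not> e' \<subseteq> S'" if e': "e' \<in> E'" for e'
  proof -
    from final.prems[OF e'] obtain e where "e \<in> E" "e - S \<subseteq> e' - S'" by blast
    with final.hyps show ?thesis by blast
  qed
  then show ?case by simp
next
  case (dominator x F S)
  from dominator.IH[OF dominator.prems] dominator.hyps(1) show ?case by (intro dwin.dominator)
next
  case (staller F S)
  show ?case
  proof (rule dwin.staller[OF staller.hyps(1)])
    fix x assume "x \<in> F"
    then show "dwin E' Dominator (insert x S') (F - {x})"
    proof (rule staller.IH)
      fix e' assume "e' \<in> E'"
      from staller.prems[OF this] obtain e where "e \<in> E" "e - S \<subseteq> e' - S'" by blast
      then show "\<exists>e \<in> E. e - insert x S \<subseteq> e' - insert x S'" by (intro bexI[of _ e]) auto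
    qed
  qed
qed

text \<open>Staller answers in the pair whenever Dominator enters it.\<close>

lemma dwin_drop_pair:
  assumes "dwin E q S F" "F = insert a (insert b F')" "a \<noteq> b" "a \<notin> F'" "b \<notin> F'"
  shows "dwin E q S F'"
  using assms
proof (induction arbitrary: F' a b rule: dwin.induct)
  case (dominator x F S)
  consider "x = a" | "x = b" | "x \<in> F'" "x \<noteq> a" "x \<noteq> b" using dominator by blast
  then show ?case
  proof cases
    case 1
    then have "F - {x} = insert b F'" using dominator by auto
    then have "dwin E Dominator (insert b S) (insert b F' - {b})"
      using dominator.hyps(2) by (metis dwin_Staller_iff insertI1 insert_not_empty)
    then have "dwin E Dominator (insert b S) F'" using dominator.prems by simp
    \<comment> \<open>Dominator wins although Staller owns \<open>b\<close>, hence also if she does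
      not.\<close>
    then show ?thesis by (rule dwin_mono) auto
  next
    case 2
    then have "F - {x} = insert a F'" using dominator by auto
    then have "dwin E Dominator (insert a S) (insert a F' - {a})"
      using dominator.hyps(2) by (metis dwin_Staller_iff insertI1 insert_not_empty)
    then have "dwin E Dominator (insert a S) F'" using dominator.prems by simp
    then show ?thesis by (rule dwin_mono) auto
  next
    case 3
    then have "dwin E Staller S (F' - {x})"
      using dominator.prems by (intro dominator.IH[of a b]) auto
    then show ?thesis using 3 by (intro dwin.dominator)
  qed
next
  case (staller F S)
  show ?case
  proof (cases "F' = {}")
    case True
    have "dwin E Staller S F" using staller.hyps by (rule dwin.staller)
    then show ?thesis using True by (auto dest: dwin_not_claimed)
  next
    case False
    show ?thesis
    proof (rule dwin.staller[OF False])
      fix x assume "x \<in> F'"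
      then show "dwin E Dominator (insert x S) (F' - {x})"
        using staller.prems by (intro staller.IH[of x a b]) auto
    qed
  qed
qed auto

text \<open>The disjunction assumed for each \<open>e\<close> is the invariant: a target has lost a
  vertex to Dominator or still contains an untouched pair. A round consumes two vertices of
  \<open>F\<close>, hence the induction over proper subsets.\<close>

lemma dwin_pairing:
  assumes "finite F" "disjoint P" "\<And>p. p \<in> P \<Longrightarrow> card p = 2"
    and "\<And>e. e \<in> E \<Longrightarrow> \<not> e \<subseteq> S \<union> F \<or> (\<exists>p \<in> P. p \<subseteq> F \<and> p \<subseteq> e)"
    and "S \<inter> F = {}"
  shows "dwin E Staller S F"
  using assms
proof (induction F arbitrary: S rule: finite_psubset_induct)
  case (psubset F)
  show ?case
  proof (cases "F = {}")
    case True
    have "\<not> e \<subseteq> S" if "e \<in> E" for e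
      using psubset.prems(2) psubset.prems(3)[OF that] True
      by (metis Un_empty_right card.empty subset_empty zero_neq_numeral)
    then show ?thesis using True by auto
  next
    case False
    show ?thesis
    proof (rule dwin.staller[OF False])
      fix x assume x: "x \<in> F"
      show "dwin E Dominator (insert x S) (F - {x})"
      proof (cases "F - {x} = {}")
        case True
        then have F: "F = {x}" using x by blast
        have "\<not> e \<subseteq> insert x S" if e: "e \<in> E" for e
        proof
          assume "e \<subseteq> insert x S"
          then obtain p where p: "p \<in> P" "p \<subseteq> {x}" using psubset.prems(3)[OF e] F by auto
          then have "card p \<le> card {x}" by (intro card_mono) auto
          then show False using psubset.prems(2)[OF p(1)] by simp
        qed
        then show ?thesis unfolding True by simp
      next
        case ne: False
        \<comment> \<open>If \<open>x\<close> lies in no untouched pair, any free vertex serves as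
          the answer.\<close>
        have partner: "\<exists>z \<in> F - {x}. \<forall>p \<in> P. p \<subseteq> F \<and> x \<in> p \<longrightarrow> p = {x, z}"
        proof (cases "\<exists>p \<in> P. p \<subseteq> F \<and> x \<in> p")
          case True
          then obtain p where p: "p \<in> P" "p \<subseteq> F" "x \<in> p" by blast
          then obtain z where z: "p = {x, z}" "x \<noteq> z"
            using psubset.prems(2)[OF p(1)] by (metis card_2_iff doubleton_eq_iff insertE singletonD)
          have "q = p" if "q \<in> P" "x \<in> q" for q
            using disjointD[OF psubset.prems(1) that(1) p(1)] that p by blast
          then show ?thesis using z p by (intro bexI[of _ z]) auto
        next
          case False
          then show ?thesis using ne by blast
        qed
        then obtain z where z: "z \<in> F - {x}" "\<And>p. p \<in> P \<Longrightarrow> p \<subseteq> F \<Longrightarrow> x \<in> p \<Longrightarrow> p = {x, z}"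
          by blast
        have "dwin E Staller (insert x S) (F - {x} - {z})"
        proof (rule psubset.IH)
          fix e assume "e \<in> E"
          then consider "\<not> e \<subseteq> S \<union> F" | p where "p \<in> P" "p \<subseteq> F" "p \<subseteq> e" using psubset.prems(3) by blast
          then show "\<not> e \<subseteq> insert x S \<union> (F - {x} - {z}) \<or> (\<exists>p \<in> P. p \<subseteq> F - {x} - {z} \<and> p \<subseteq> e)"
          proof cases
            case 1 then show ?thesis using x by blast
          next
            case 2
            \<comment> \<open>Either the pair inside \<open>e\<close> is the one just broken, and
              then \<open>z\<close> blocks \<open>e\<close> for good, or it is still
              untouched.\<close>
            show ?thesis
            proof (cases "z \<in> p")
              case True
              then have "\<not> e \<subseteq> insert x S \<union> (F - {x} - {z})" using 2 z(1) psubset.prems(4) by blast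
              then show ?thesis ..
            next
              case False
              then have "x \<notin> p" using z(2)[OF 2(1,2)] by blast
              with False 2 show ?thesis by blast
            qed
          qed
        qed (use x psubset.prems in auto)
        then show ?thesis using z(1) by (intro dwin.dominator)
      qed
    qed
  qed
qed

section \<open>Strategies and positions\<close>

definition nbs :: "('a, 'b) pre_digraph \<Rightarrow> 'a \<Rightarrow> 'a set" where
  "nbs G v = {u. v \<rightarrow>\<^bsub>G\<^esub> u}"

abbreviation nbhds :: "('a, 'b) pre_digraph \<Rightarrow> 'a set set" where
  "nbhds G \<equiv> nbs G ` verts G"

lemma to_move_Suc: "to_move p (Suc n) = opponent (to_move p n)"
  by (cases p) (auto simp: to_move_def)

lemma selected_subset: "selected p h q \<subseteq> set h"
  by (auto simp: selected_def)

lemma selected_Nil [simp]: "selected p [] q = {}"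
  by (simp add: selected_def)

lemma selected_snoc:
  "selected p (h @ [x]) q = (if to_move p (length h) = q then insert x (selected p h q) else selected p h q)"
proof -
  have "selected p h q = (\<lambda>i. (h @ [x]) ! i) ` {i. i < length h \<and> to_move p i = q}"
    unfolding selected_def by (force simp: nth_append)
  moreover have "selected p (h @ [x]) q = (\<lambda>i. (h @ [x]) ! i) ` {i. i < Suc (length h) \<and> to_move p i = q}"
    unfolding selected_def by force
  moreover have "{i. i < Suc (length h) \<and> to_move p i = q} =
      (if to_move p (length h) = q then insert (length h) else id) {i. i < length h \<and> to_move p i = q}"
    by (auto simp: less_Suc_eq)
  ultimately show ?thesis by simp
qed

lemma selected_take: "selected p (take k h) q \<subseteq> selected p h q"
  by (auto simp: selected_def)

lemma selected_Un: "selected p h Dominator \<union> selected p h Staller = set h"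
  by (auto simp: selected_def in_set_conv_nth) (metis player.exhaust)

lemma selected_Int: "distinct h \<Longrightarrow> selected p h Dominator \<inter> selected p h Staller = {}"
  by (auto simp: selected_def nth_eq_iff_index_eq)

context graph begin

lemma nbs_verts: "nbs G v \<subseteq> verts G"
  by (auto simp: nbs_def dest: adj_in_verts)

text \<open>Dominator's set only grows, so the complete play decides; there it is total dominating
  iff its complement contains no open neighbourhood.\<close>

lemma dominator_wins_play_iff:
  assumes "distinct h" "set h = verts G"
  shows "dominator_wins_play G p h \<longleftrightarrow> (\<forall>e \<in> nbhds G. \<not> e \<subseteq> selected p h Staller)"
proof
  assume "dominator_wins_play G p h"
  then obtain k where k: "total_dominating_set G (selected p (take k h) Dominator)"
    by (auto simp: dominator_wins_play_def)
  show "\<forall>e \<in> nbhds G. \<not> e \<subseteq> selected p h Staller"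
  proof safe
    fix v assume v: "v \<in> verts G" "nbs G v \<subseteq> selected p h Staller"
    then obtain u where "u \<in> selected p (take k h) Dominator" "u \<in> nbs G v"
      using k by (auto simp: total_dominating_set_def nbs_def)
    then show False using v selected_take[of p k h Dominator] selected_Int[OF assms(1), of p] by blast
  qed
next
  assume *: "\<forall>e \<in> nbhds G. \<not> e \<subseteq> selected p h Staller"
  have "\<exists>u \<in> selected p h Dominator. v \<rightarrow>\<^bsub>G\<^esub> u" if "v \<in> verts G" for v
  proof -
    obtain u where "u \<in> nbs G v" "u \<notin> selected p h Staller" using * \<open>v \<in> verts G\<close> by blast
    then show ?thesis using selected_Un[of p h] nbs_verts[of v] assms(2) by (auto simp: nbs_def)
  qed
  then have "total_dominating_set G (selected p (take (length h) h) Dominator)"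
    using selected_subset[of p h Dominator] assms(2) by (auto simp: total_dominating_set_def)
  then show "dominator_wins_play G p h" unfolding dominator_wins_play_def by blast
qed

text \<open>Staller's winning positions are encoded as the failure of \<open>dwin\<close>, so that
  one invariant serves both players.\<close>

definition favourable :: "player \<Rightarrow> player \<Rightarrow> 'a list \<Rightarrow> bool" where
  "favourable p q h \<longleftrightarrow>
     (dwin (nbhds G) (to_move p (length h)) (selected p h Staller) (verts G - set h) \<longleftrightarrow> q = Dominator)"

lemma favourable_own_move:
  assumes "favourable p q h" "set h \<subset> verts G" "to_move p (length h) = q"
  shows "\<exists>x \<in> verts G - set h. favourable p q (h @ [x])"
proof -
  have ne: "verts G - set h \<noteq> {}" using assms(2) by blast
  show ?thesis
    using assms(1) dwin_Dominator_iff[OF ne] dwin_Staller_iff[OF ne]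
    by (cases q) (auto simp: favourable_def to_move_Suc assms(3) selected_snoc Diff_insert[symmetric])
qed

lemma favourable_other_move:
  assumes "favourable p q h" "x \<in> verts G - set h" "to_move p (length h) \<noteq> q"
  shows "favourable p q (h @ [x])"
proof -
  have ne: "verts G - set h \<noteq> {}" using assms(2) by blast
  have "to_move p (length h) = opponent q" using assms(3) by (cases q; cases "to_move p (length h)") auto
  then show ?thesis
    using assms(1,2) dwin_Dominator_iff[OF ne] dwin_Staller_iff[OF ne]
    by (cases q) (auto simp: favourable_def to_move_Suc selected_snoc Diff_insert[symmetric])
qed

text \<open>The strategy picks some move that keeps the position favourable. The invariant is
  carried along the histories that follow it, including those in which the opponent moves
  arbitrarily.\<close>

lemma favourable_wins_game:
  assumes "favourable p q []"
  shows "wins_game G p q"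
proof -
  define \<sigma> where "\<sigma> h = (SOME x. x \<in> verts G - set h \<and> favourable p q (h @ [x]))" for h
  have \<sigma>: "\<sigma> h \<in> verts G - set h \<and> favourable p q (h @ [\<sigma> h])"
    if "favourable p q h" "set h \<subset> verts G" "to_move p (length h) = q" for h
    unfolding \<sigma>_def by (rule someI_ex) (use favourable_own_move[OF that] in blast)
  have fav: "favourable p q h" if "position G h" "follows p q \<sigma> h" for h
    using that
  proof (induction h rule: rev_induct)
    case (snoc x h)
    have pos: "position G h" "set h \<subset> verts G" "x \<in> verts G - set h"
      using snoc.prems(1) by (auto simp: position_def)
    have fol: "follows p q \<sigma> h" "to_move p (length h) = q \<Longrightarrow> x = \<sigma> h"
      using snoc.prems(2) by (auto simp: follows_def nth_append)
        (metis less_Suc_eq order_less_imp_le take_append)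
    from snoc.IH[OF pos(1) fol(1)] show ?case
      using \<sigma>[OF _ pos(2)] favourable_other_move[OF _ pos(3)] fol(2) by blast
  qed (use assms in simp)
  have "winning_strategy G p q \<sigma>"
    unfolding winning_strategy_def
  proof (intro conjI allI impI; elim conjE)
    fix h assume "position G h" "follows p q \<sigma> h" "set h \<noteq> verts G" "to_move p (length h) = q"
    then show "\<sigma> h \<in> verts G - set h" using \<sigma> fav by (auto simp: position_def psubset_eq)
  next
    fix h assume h: "position G h" "follows p q \<sigma> h" "set h = verts G"
    then have "favourable p q h" using fav by blast
    then show "wins_play G p q h"
      using h dominator_wins_play_iff[of h p] by (cases q) (auto simp: favourable_def position_def)
  qed
  then show ?thesis by (auto simp: wins_game_def)
qed

text \<open>Playing the two strategies against each other produces a complete play that both players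
  would have won.\<close>

lemma not_both_win:
  assumes "wins_game G p Dominator" "wins_game G p Staller"
  shows False
proof -
  obtain \<sigma> \<tau> where \<sigma>: "winning_strategy G p Dominator \<sigma>" and \<tau>: "winning_strategy G p Staller \<tau>"
    using assms by (auto simp: wins_game_def)
  have "\<exists>h. position G h \<and> follows p Dominator \<sigma> h \<and> follows p Staller \<tau> h \<and> length h = k"
    if "k \<le> card (verts G)" for k
    using that
  proof (induction k)
    case 0
    then show ?case by (intro exI[of _ "[]"]) (auto simp: position_def follows_def)
  next
    case (Suc k)
    then obtain h where h: "position G h" "follows p Dominator \<sigma> h" "follows p Staller \<tau> h" "length h = k"
      by auto
    have "set h \<noteq> verts G" using h Suc.prems distinct_card[of h] by (auto simp: position_def)
    define x where "x = (if to_move p k = Dominator then \<sigma> h else \<tau> h)"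
    have "x \<in> verts G - set h"
    proof (cases "to_move p k")
      case Dominator
      then show ?thesis
        using \<sigma> h \<open>set h \<noteq> verts G\<close> unfolding winning_strategy_def x_def by auto
    next
      case Staller
      then show ?thesis
        using \<tau> h \<open>set h \<noteq> verts G\<close> unfolding winning_strategy_def x_def by auto
    qed
    then have "position G (h @ [x])" using h by (auto simp: position_def)
    moreover have "follows p Dominator \<sigma> (h @ [x])" "follows p Staller \<tau> (h @ [x])"
      using h by (auto simp: follows_def nth_append x_def less_Suc_eq)
    ultimately show ?case using h(4) by (intro exI[of _ "h @ [x]"]) auto
  qed
  then obtain h where h: "position G h" "follows p Dominator \<sigma> h" "follows p Staller \<tau> h"
    "length h = card (verts G)" by blast
  then have "set h = verts G" by (intro card_subset_eq) (auto simp: position_def distinct_card)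
  then have "wins_play G p Dominator h" "wins_play G p Staller h"
    using h \<sigma> \<tau> unfolding winning_strategy_def by blast+
  then show False by simp
qed

text \<open>This is determinacy: the position is favourable to one player, who has a strategy, and
  then the other has none. Histories and strategies can be forgotten from here on.\<close>

lemma wins_game_iff:
  "wins_game G p Dominator \<longleftrightarrow> dwin (nbhds G) p {} (verts G)"
  "wins_game G p Staller \<longleftrightarrow> \<not> dwin (nbhds G) p {} (verts G)"
proof -
  have "favourable p Dominator [] \<longleftrightarrow> dwin (nbhds G) p {} (verts G)"
    "favourable p Staller [] \<longleftrightarrow> \<not> dwin (nbhds G) p {} (verts G)"
    by (auto simp: favourable_def to_move_def)
  then show "wins_game G p Dominator \<longleftrightarrow> dwin (nbhds G) p {} (verts G)"
    "wins_game G p Staller \<longleftrightarrow> \<not> dwin (nbhds G) p {} (verts G)"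
    using favourable_wins_game not_both_win by blast+
qed

end

section \<open>Blocks as vertex sets\<close>

text \<open>Connectivity via closed subsets speaks of vertex sets directly, without forming
  subgraphs or paths. The empty set counts as connected, which makes singletons
  nonseparable.\<close>

definition conn :: "('a, 'b) pre_digraph \<Rightarrow> 'a set \<Rightarrow> bool" where
  "conn G A \<longleftrightarrow> (\<forall>U. U \<subseteq> A \<and> U \<noteq> {} \<and> (\<forall>u \<in> U. nbs G u \<inter> A \<subseteq> U) \<longrightarrow> U = A)"

text \<open>Vertex sets inducing nonseparable subgraphs; the blocks are induced by the maximal ones.\<close>

definition nsep :: "('a, 'b) pre_digraph \<Rightarrow> 'a set \<Rightarrow> bool" where
  "nsep G A \<longleftrightarrow> A \<noteq> {} \<and> A \<subseteq> verts G \<and> conn G A \<and> (\<forall>w \<in> A. conn G (A - {w}))"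

definition vblock :: "('a, 'b) pre_digraph \<Rightarrow> 'a set \<Rightarrow> bool" where
  "vblock G A \<longleftrightarrow> nsep G A \<and> (\<forall>A'. nsep G A' \<and> A \<subseteq> A' \<longrightarrow> A' = A)"

lemma connI:
  "(\<And>U. U \<subseteq> A \<Longrightarrow> U \<noteq> {} \<Longrightarrow> (\<And>u. u \<in> U \<Longrightarrow> nbs G u \<inter> A \<subseteq> U) \<Longrightarrow> A \<subseteq> U) \<Longrightarrow> conn G A"
  unfolding conn_def by blast

lemma connD:
  "conn G A \<Longrightarrow> U \<subseteq> A \<Longrightarrow> U \<noteq> {} \<Longrightarrow> (\<And>u. u \<in> U \<Longrightarrow> nbs G u \<inter> A \<subseteq> U) \<Longrightarrow> U = A"
  unfolding conn_def by blast

lemma conn_mono: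
  assumes "conn G A" "\<And>v. v \<in> A \<Longrightarrow> nbs G v \<inter> A \<subseteq> nbs H v"
  shows "conn H A"
proof (rule connI)
  fix U assume U: "U \<subseteq> A" "U \<noteq> {}" "\<And>u. u \<in> U \<Longrightarrow> nbs H u \<inter> A \<subseteq> U"
  have "U = A" using assms(2) U by (intro connD[OF assms(1)]) blast+
  then show "A \<subseteq> U" by simp
qed

lemma conn_cong:
  "(\<And>v. v \<in> A \<Longrightarrow> nbs G v \<inter> A = nbs H v \<inter> A) \<Longrightarrow> conn G A \<longleftrightarrow> conn H A"
  by (metis conn_mono inf_le1)

lemma conn_empty [simp]: "conn G {}" and conn_singleton [simp]: "conn G {v}"
  by (auto simp: conn_def)

lemma conn_Un:
  assumes "conn G P" "conn G Q" "P \<inter> Q \<noteq> {}"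
  shows "conn G (P \<union> Q)"
proof (rule connI)
  fix U assume U: "U \<subseteq> P \<union> Q" "U \<noteq> {}" "\<And>u. u \<in> U \<Longrightarrow> nbs G u \<inter> (P \<union> Q) \<subseteq> U"
  have *: "R \<subseteq> U" if "conn G R" "R \<subseteq> P \<union> Q" "U \<inter> R \<noteq> {}" for R
    using connD[OF that(1), of "U \<inter> R"] that U(3) by blast
  from U(1,2) have "U \<inter> P \<noteq> {} \<or> U \<inter> Q \<noteq> {}" by blast
  then show "P \<union> Q \<subseteq> U" using *[OF assms(1)] *[OF assms(2)] assms(3) by blast
qed

text \<open>Whichever vertex is deleted, one of the two common vertices survives and joins the two
  connected remainders.\<close>

lemma nsep_Un:
  assumes "nsep G A" "nsep G B" "x \<in> A \<inter> B" "y \<in> A \<inter> B" "x \<noteq> y"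
  shows "nsep G (A \<union> B)"
proof -
  have minus: "conn G (C - {w})" if "nsep G C" for C w
    using that by (cases "w \<in> C") (auto simp: nsep_def)
  have "conn G (A \<union> B)" using assms by (intro conn_Un) (auto simp: nsep_def)
  moreover have "conn G (A \<union> B - {w})" for w
    unfolding Un_Diff using assms by (intro conn_Un minus) auto
  ultimately show ?thesis using assms by (auto simp: nsep_def)
qed

lemma vblock_eqI:
  assumes "vblock G A" "vblock G B" "x \<in> A \<inter> B" "y \<in> A \<inter> B" "x \<noteq> y"
  shows "A = B"
  using nsep_Un[of G A B x y] assms unfolding vblock_def by (metis Un_upper1 Un_upper2)

lemma nbs_induce: "nbs (G \<restriction> A) v = (if v \<in> A then nbs G v \<inter> A else {})"
  by (auto simp: nbs_def arcs_ends_conv)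

lemma conn_induce: "A \<subseteq> B \<Longrightarrow> conn (G \<restriction> B) A \<longleftrightarrow> conn G A"
  by (rule conn_cong) (auto simp: nbs_induce)

lemma nsep_induce:
  assumes "A \<subseteq> B" "B \<subseteq> verts G"
  shows "nsep (G \<restriction> B) A \<longleftrightarrow> nsep G A"
proof -
  have "conn (G \<restriction> B) (A - {w}) \<longleftrightarrow> conn G (A - {w})" for w using assms by (intro conn_induce) blast
  then show ?thesis using assms conn_induce[of A B G] by (auto simp: nsep_def)
qed

lemma induce_induce: "B \<subseteq> A \<Longrightarrow> (G \<restriction> A) \<restriction> B = G \<restriction> B"
  by (rule pre_digraph.equality) auto

lemma nbs_subgraph: "subgraph H G \<Longrightarrow> nbs H v \<subseteq> nbs G v"
  unfolding nbs_def using arcs_ends_mono by blast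

lemma nsep_subgraph:
  assumes "subgraph H G" "nsep H A"
  shows "nsep G A"
proof -
  have "conn H B \<Longrightarrow> conn G B" for B
    using nbs_subgraph[OF assms(1)] by (intro conn_mono[of H B G]) auto
  then show ?thesis using assms subgraph_imp_subverts[OF assms(1)] unfolding nsep_def by blast
qed

context graph begin

lemma nbs_sym: "u \<in> nbs G v \<longleftrightarrow> v \<in> nbs G u"
  by (auto simp: nbs_def intro: graph_symmetric)

lemma nbs_irrefl: "v \<notin> nbs G v"
  by (auto simp: nbs_def dest: adj_not_same)

lemma graph_induce: "A \<subseteq> verts G \<Longrightarrow> graph (G \<restriction> A)"
  by (meson digraph.graphI digraphI_induced induced_graph_imp_symmetric induced_induce sym_arcs)

lemma conn_verts_iff: "conn G (verts G) \<longleftrightarrow> (\<forall>u \<in> verts G. \<forall>v \<in> verts G. u \<rightarrow>\<^sup>* v)"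
proof (intro iffI ballI)
  fix u v assume *: "conn G (verts G)" "u \<in> verts G" "v \<in> verts G"
  have "{w. u \<rightarrow>\<^sup>* w} = verts G"
    using * by (intro connD[OF *(1)])
      (auto simp: nbs_def dest: reachable_in_verts intro: reachable_adj_trans)
  then show "u \<rightarrow>\<^sup>* v" using * by blast
next
  assume reach: "\<forall>u \<in> verts G. \<forall>v \<in> verts G. u \<rightarrow>\<^sup>* v"
  show "conn G (verts G)"
  proof (rule connI, rule subsetI)
    fix U w assume U: "U \<subseteq> verts G" "U \<noteq> {}" "\<And>u. u \<in> U \<Longrightarrow> nbs G u \<inter> verts G \<subseteq> U" and "w \<in> verts G"
    then obtain u where "u \<in> U" "u \<rightarrow>\<^sup>* w" using reach by blast
    from \<open>u \<rightarrow>\<^sup>* w\<close> show "w \<in> U"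
    proof (induction rule: reachable_induct)
      case (step x y)
      then show ?case using U(3)[of x] adj_in_verts[of x y] by (auto simp: nbs_def)
    qed (use \<open>u \<in> U\<close> in simp)
  qed
qed

lemma connected_iff: "connected G \<longleftrightarrow> verts G \<noteq> {} \<and> conn G (verts G)"
  using reachable_mk_symmetric_eq[OF sym_arcs]
  by (auto simp: connected_def strongly_connected_def conn_verts_iff)

lemma del_vert_eq: "del_vert v = G \<restriction> (verts G - {v})"
  by (rule pre_digraph.equality) (auto simp: del_vert_simps)

lemma not_cut_vertex_iff:
  assumes "connected G" "v \<in> verts G"
  shows "\<not> cut_vertex G v \<longleftrightarrow> conn G (verts G - {v})"
proof -
  interpret D: graph "G \<restriction> (verts G - {v})" by (rule graph_induce) blast
  have "\<not> cut_vertex G v \<longleftrightarrow> conn (G \<restriction> (verts G - {v})) (verts G - {v})"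
    using assms D.conn_verts_iff conn_verts_iff
    unfolding cut_vertex_def del_vert_eq connected_iff by auto
  then show ?thesis by (simp add: conn_induce)
qed

lemma nonseparable_iff: "nonseparable G \<longleftrightarrow> nsep G (verts G)"
proof (cases "connected G")
  case True
  have "(\<exists>v. cut_vertex G v) \<longleftrightarrow> (\<exists>v \<in> verts G. cut_vertex G v)" by (auto simp: cut_vertex_def)
  then show ?thesis
    using True not_cut_vertex_iff[OF True] connected_iff graph_axioms unfolding nonseparable_def nsep_def by auto
next
  case False
  then show ?thesis unfolding nonseparable_def nsep_def using connected_iff by auto
qed

lemma nonseparable_induce: "A \<subseteq> verts G \<Longrightarrow> nonseparable (G \<restriction> A) \<longleftrightarrow> nsep G A"
  using graph.nonseparable_iff[OF graph_induce[of A]] nsep_induce[of A A G] by simp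

lemma subgraph_induce: "A \<subseteq> B \<Longrightarrow> B \<subseteq> verts G \<Longrightarrow> subgraph (G \<restriction> A) (G \<restriction> B)"
  by (intro subgraphI) (auto simp: compatible_def)

lemma subgraph_induceI: "A \<subseteq> verts G \<Longrightarrow> subgraph (G \<restriction> A) G"
  by (intro subgraphI) (auto simp: compatible_def wf_digraph_axioms)

lemma subgraph_induce_verts:
  assumes "subgraph H G"
  shows "subgraph H (G \<restriction> verts H)"
proof -
  have "wf_digraph H" "compatible G H" "arcs H \<subseteq> arcs G" using assms by auto
  then show ?thesis
    by (intro subgraphI) (auto simp: compatible_def wf_digraph_def)
qed

text \<open>Maximality ranges over all subgraphs, so a block must first be seen to be induced:
  adding the missing arcs between its vertices would keep it nonseparable.\<close>

lemma block_iff: "block G B \<longleftrightarrow> (\<exists>A. vblock G A \<and> B = G \<restriction> A)"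
proof
  assume "block G B"
  then have B: "subgraph B G" "nonseparable B"
    and max: "\<And>H. H \<noteq> B \<Longrightarrow> subgraph B H \<Longrightarrow> subgraph H G \<Longrightarrow> nonseparable H \<Longrightarrow> False"
    unfolding block_def max_subgraph_def by blast+
  let ?A = "verts B"
  have A: "?A \<subseteq> verts G" using B(1) by auto
  have ns: "nsep G ?A"
    using B nsep_subgraph graph.nonseparable_iff[of B] unfolding nonseparable_def by blast
  have eq: "B = G \<restriction> ?A"
    using max[of "G \<restriction> ?A"] subgraph_induce_verts[OF B(1)] subgraph_induceI[OF A]
      nonseparable_induce[OF A] ns by metis
  have "A' = ?A" if "nsep G A'" "?A \<subseteq> A'" for A'
  proof (rule ccontr)
    assume "A' \<noteq> ?A"
    then have "G \<restriction> A' \<noteq> B" by auto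
    moreover have "A' \<subseteq> verts G" using that by (auto simp: nsep_def)
    ultimately show False
      using max[of "G \<restriction> A'"] subgraph_induce[OF that(2)] subgraph_induceI[of A']
        nonseparable_induce[of A'] that eq by metis
  qed
  then show "\<exists>A. vblock G A \<and> B = G \<restriction> A" using ns eq by (auto simp: vblock_def)
next
  assume "\<exists>A. vblock G A \<and> B = G \<restriction> A"
  then obtain A where A: "vblock G A" "B = G \<restriction> A" by blast
  have AG: "A \<subseteq> verts G" using A by (auto simp: vblock_def nsep_def)
  have "H = B" if H: "subgraph B H" "subgraph H G" "nonseparable H" for H
  proof -
    have "nsep G (verts H)"
      using H nsep_subgraph graph.nonseparable_iff[of H] unfolding nonseparable_def by blast
    moreover have "A \<subseteq> verts H" using subgraph_imp_subverts[OF H(1)] A(2) by simp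
    ultimately have v: "verts H = A" using A(1) by (auto simp: vblock_def)
    have "arcs H \<subseteq> arcs B"
      using subgraph_induce_verts[OF H(2)] unfolding v A(2) subgraph_def by blast
    then have "arcs H = arcs B" using H(1) by auto
    moreover have "tail H = tail B" "head H = head B" using H(1) by (auto simp: subgraph_def compatible_def)
    ultimately show ?thesis using v A(2) by (intro pre_digraph.equality) auto
  qed
  then show "block G B"
    unfolding block_def max_subgraph_def
    using subgraph_induceI[OF AG] nonseparable_induce[OF AG] A by (auto simp: vblock_def)
qed

lemma ex_vblock:
  assumes "nsep G A"
  obtains B where "vblock G B" "A \<subseteq> B"
proof -
  have "finite {B. nsep G B \<and> A \<subseteq> B}"
    by (rule finite_subset[of _ "Pow (verts G)"]) (auto simp: nsep_def)
  moreover have "{B. nsep G B \<and> A \<subseteq> B} \<noteq> {}" using assms by blast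
  ultimately obtain B where "B \<in> {B. nsep G B \<and> A \<subseteq> B}"
    "\<And>B'. B' \<in> {B. nsep G B \<and> A \<subseteq> B} \<Longrightarrow> B \<subseteq> B' \<Longrightarrow> B = B'"
    using finite_has_maximal by (metis (no_types, lifting))
  then show ?thesis using that unfolding vblock_def by blast
qed

text \<open>By symmetry of adjacency the complement of a closed set within \<open>A\<close> is
  closed as well, so the part can be chosen to avoid a prescribed \<open>x\<close>.\<close>

lemma not_connE:
  assumes "\<not> conn G A"
  obtains U where "U \<subseteq> A" "U \<noteq> {}" "U \<noteq> A" "x \<notin> U" "\<And>u. u \<in> U \<Longrightarrow> nbs G u \<inter> A \<subseteq> U"
proof -
  obtain U where U: "U \<subseteq> A" "U \<noteq> {}" "\<And>u. u \<in> U \<Longrightarrow> nbs G u \<inter> A \<subseteq> U" "U \<noteq> A"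
    using assms unfolding conn_def by blast
  have "nbs G u \<inter> A \<subseteq> A - U" if "u \<in> A - U" for u using that U(3) nbs_sym by blast
  then show ?thesis using U that[of U] that[of "A - U"] by blast
qed

lemma nsep_edge:
  assumes "u \<in> nbs G v"
  shows "nsep G {u, v}"
proof -
  have "u \<noteq> v" "v \<in> nbs G u" using assms nbs_irrefl nbs_sym by blast+
  then have "conn G {u, v}" using assms by (intro connI) blast
  moreover have "{u, v} - {u} = {v}" "{u, v} - {v} = {u}" using \<open>u \<noteq> v\<close> by auto
  moreover have "{u, v} \<subseteq> verts G" using assms nbs_verts nbs_sym by blast
  ultimately show ?thesis by (auto simp: nsep_def)
qed

lemma nsep_singleton: "v \<in> verts G \<Longrightarrow> nsep G {v}"
  by (auto simp: nsep_def)

end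

section \<open>Cycles and cacti\<close>

text \<open>An enumeration around a cycle induced by \<open>A\<close>, with free starting point.
  Later \<open>f 0\<close> is rotated to the attaching vertex or to Dominator's vertex.\<close>

definition cycle_enum :: "('a, 'b) pre_digraph \<Rightarrow> 'a set \<Rightarrow> nat \<Rightarrow> (nat \<Rightarrow> 'a) \<Rightarrow> bool" where
  "cycle_enum G A n f \<longleftrightarrow> 3 \<le> n \<and> bij_betw f {..<n} A \<and>
     (\<forall>i < n. \<forall>j < n. f j \<in> nbs G (f i) \<longleftrightarrow> j = Suc i mod n \<or> i = Suc j mod n)"

lemma cycle_enum_verts:
  assumes "cycle_graph n C"
  shows "\<exists>f. cycle_enum C (verts C) n f"
proof -
  obtain h where h: "pre_digraph.digraph_isomorphism C h" "with_proj (std_cycle n) = app_iso h C"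
    using assms by (auto simp: cycle_graph_def digraph_iso_def)
  have n: "3 \<le> n" and "graph C" using assms by (auto simp: cycle_graph_def)
  interpret C: graph C by fact
  have inj: "inj_on (iso_verts h) (verts C)" by (rule C.digraph_isomorphism_inj_on_verts[OF h(1)])
  have im: "iso_verts h ` verts C = {..<n}"
    using arg_cong[OF h(2), of verts] by (simp add: std_cycle_def)
  have "arcs_ends (with_proj (std_cycle n)) = (\<lambda>(u, v). (iso_verts h u, iso_verts h v)) ` arcs_ends C"
    unfolding h(2) by (rule C.arcs_ends_app_iso_eq[OF h(1)])
  then have ends: "parcs (std_cycle n) = (\<lambda>(u, v). (iso_verts h u, iso_verts h v)) ` arcs_ends C"
    by simp
  let ?f = "the_inv_into (verts C) (iso_verts h)"
  have bij: "bij_betw ?f {..<n} (verts C)"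
    using inj im by (metis bij_betw_imageI bij_betw_the_inv_into)
  have f: "?f i \<in> verts C" "iso_verts h (?f i) = i" if "i < n" for i
    using that inj im bij_betwE[OF bij] f_the_inv_into_f[OF inj, of i] by auto
  have "?f j \<in> nbs C (?f i) \<longleftrightarrow> j = Suc i mod n \<or> i = Suc j mod n" if "i < n" "j < n" for i j
  proof -
    have "?f j \<in> nbs C (?f i) \<longleftrightarrow> (i, j) \<in> (\<lambda>(u, v). (iso_verts h u, iso_verts h v)) ` arcs_ends C"
    proof
      assume "?f j \<in> nbs C (?f i)"
      then show "(i, j) \<in> (\<lambda>(u, v). (iso_verts h u, iso_verts h v)) ` arcs_ends C"
        using f(2)[OF that(1)] f(2)[OF that(2)] by (intro rev_image_eqI[of "(?f i, ?f j)"]) (auto simp: nbs_def)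
    next
      assume "(i, j) \<in> (\<lambda>(u, v). (iso_verts h u, iso_verts h v)) ` arcs_ends C"
      then obtain u v where uv: "u \<rightarrow>\<^bsub>C\<^esub> v" "i = iso_verts h u" "j = iso_verts h v" by auto
      then have "?f i = u" "?f j = v"
        using C.adj_in_verts[OF uv(1)] inj by (auto simp: the_inv_into_f_f)
      then show "?f j \<in> nbs C (?f i)" using uv by (simp add: nbs_def)
    qed
    then show ?thesis using that unfolding ends[symmetric] by (auto simp: std_cycle_def)
  qed
  then show ?thesis using n bij by (auto simp: cycle_enum_def)
qed

lemma cycle_enum_induce:
  "cycle_enum (G \<restriction> A) A n f \<longleftrightarrow> cycle_enum G A n f"
  unfolding cycle_enum_def by (auto simp: nbs_induce dest: bij_betwE)

lemma cycle_graph_induceE: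
  assumes "cycle_graph n (G \<restriction> A)"
  obtains f where "cycle_enum G A n f"
  using cycle_enum_verts[OF assms] cycle_enum_induce by fastforce

lemma cycle_enum_card: "cycle_enum G A n f \<Longrightarrow> card A = n"
  by (auto simp: cycle_enum_def dest: bij_betw_same_card)

lemma cycle_enum_finite: "cycle_enum G A n f \<Longrightarrow> finite A"
  by (auto simp: cycle_enum_def dest: bij_betw_finite)

lemma cycle_enum_mem: "cycle_enum G A n f \<Longrightarrow> i < n \<Longrightarrow> f i \<in> A"
  by (auto simp: cycle_enum_def dest: bij_betwE)

lemma cycle_enum_eq_iff: "cycle_enum G A n f \<Longrightarrow> i < n \<Longrightarrow> j < n \<Longrightarrow> f i = f j \<longleftrightarrow> i = j"
  by (auto simp: cycle_enum_def bij_betw_def dest: inj_onD)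

lemma cycle_enum_image: "cycle_enum G A n f \<Longrightarrow> A = f ` {..<n}"
  by (auto simp: cycle_enum_def bij_betw_def)

lemma cycle_enum_index:
  assumes "cycle_enum G A n f" "v \<in> A"
  obtains i where "i < n" "v = f i"
  using assms cycle_enum_image by fastforce

lemma mod_add_cancel_right:
  fixes j m k n :: nat
  assumes "0 < n"
  shows "(j + k) mod n = (m + k) mod n \<longleftrightarrow> j mod n = m mod n"
proof
  assume *: "(j + k) mod n = (m + k) mod n"
  have shift: "l + k + (n * k - k) = l + n * k" for l using assms by (cases n) auto
  have "(j + k + (n * k - k)) mod n = (m + k + (n * k - k)) mod n"
    using * by (metis mod_add_left_eq)
  then show "j mod n = m mod n" unfolding shift by simp
next
  assume "j mod n = m mod n"
  then show "(j + k) mod n = (m + k) mod n" by (metis mod_add_left_eq)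
qed

lemma cycle_enum_rotate:
  assumes "cycle_enum G A n f"
  shows "cycle_enum G A n (\<lambda>i. f ((i + k) mod n))"
proof -
  have n: "3 \<le> n" "0 < n" using assms by (auto simp: cycle_enum_def)
  have inj: "inj_on (\<lambda>i. (i + k) mod n) {..<n}"
    by (rule inj_onI) (use mod_add_cancel_right[OF n(2)] in auto)
  have "bij_betw (\<lambda>i. (i + k) mod n) {..<n} {..<n}"
    using n inj by (intro bij_betw_imageI endo_inj_surj) auto
  then have "bij_betw (\<lambda>i. f ((i + k) mod n)) {..<n} A"
    using assms bij_betw_trans[of _ _ _ f A] unfolding cycle_enum_def by (auto simp: comp_def)
  moreover have "(j + k) mod n = Suc ((i + k) mod n) mod n \<longleftrightarrow> j = Suc i mod n" if "j < n" for i j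
    using mod_add_cancel_right[OF n(2), of j k "Suc i"] that by (simp add: mod_Suc_eq)
  ultimately show ?thesis using assms n unfolding cycle_enum_def by simp
qed

lemma cycle_enum_start:
  assumes "cycle_enum G A n f" "c \<in> A"
  obtains g where "cycle_enum G A n g" "g 0 = c"
proof -
  obtain k where "k < n" "c = f k" using cycle_enum_index[OF assms] .
  then show ?thesis using that[OF cycle_enum_rotate[OF assms(1), of k]] by simp
qed

lemma cycle_enum_adj_Suc: "cycle_enum G A n f \<Longrightarrow> Suc i < n \<Longrightarrow> f (Suc i) \<in> nbs G (f i)"
  by (auto simp: cycle_enum_def)

text \<open>The wrap-around is written with \<open>if\<close> instead of \<open>mod\<close>, so that
  concrete indices simplify.\<close>

lemma cycle_enum_nbs:
  assumes "cycle_enum G A n f" "i < n"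
  shows "nbs G (f i) \<inter> A =
    {f (if Suc i = n then 0 else Suc i), f (if i = 0 then n - 1 else i - 1)}"
proof -
  have n: "3 \<le> n" and adj: "\<And>j. j < n \<Longrightarrow> f j \<in> nbs G (f i) \<longleftrightarrow> j = Suc i mod n \<or> i = Suc j mod n"
    using assms by (auto simp: cycle_enum_def)
  have "j = Suc i mod n \<or> i = Suc j mod n \<longleftrightarrow>
      j = (if Suc i = n then 0 else Suc i) \<or> j = (if i = 0 then n - 1 else i - 1)" if "j < n" for j
    using that assms(2) n by (auto simp: mod_Suc)
  then have "nbs G (f i) \<inter> A =
      f ` {j. j < n \<and> (j = (if Suc i = n then 0 else Suc i) \<or> j = (if i = 0 then n - 1 else i - 1))}"
    using adj unfolding cycle_enum_image[OF assms(1)] by blast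
  also have "{j. j < n \<and> (j = (if Suc i = n then 0 else Suc i) \<or> j = (if i = 0 then n - 1 else i - 1))} =
      {if Suc i = n then 0 else Suc i, if i = 0 then n - 1 else i - 1}"
    using assms(2) n by auto
  finally show ?thesis by simp
qed

lemma cycle_enum_card_nbs:
  assumes "cycle_enum G A n f" "v \<in> A"
  shows "card (nbs G v \<inter> A) = 2"
proof -
  obtain i where i: "i < n" "v = f i" using cycle_enum_index[OF assms] .
  have "3 \<le> n" using assms by (auto simp: cycle_enum_def)
  then show ?thesis
    unfolding i(2) cycle_enum_nbs[OF assms(1) i(1)] using i(1)
    by (auto simp: card_2_iff' cycle_enum_eq_iff[OF assms(1)])
qed

context graph begin

text \<open>After a rotation the deleted vertex is \<open>g 0\<close>, and the rest is the path
  \<open>g 1, ..., g (n - 1)\<close>, assembled edge by edge.\<close>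

lemma nsep_cycle_enum:
  assumes "cycle_enum G A n f" "A \<subseteq> verts G"
  shows "nsep G A"
proof -
  have n: "3 \<le> n" using assms by (auto simp: cycle_enum_def)
  have edge: "conn G {u, v}" if "u \<in> nbs G v" for u v using nsep_edge[OF that] by (simp add: nsep_def)
  have minus: "conn G (A - {c}) \<and> conn G A" if c: "c \<in> A" for c
  proof -
    obtain g where g: "cycle_enum G A n g" "g 0 = c" using cycle_enum_start[OF assms(1) c] .
    have path: "conn G (g ` {1..Suc m})" if "Suc m < n" for m
      using that
    proof (induction m)
      case (Suc m)
      have "{1..Suc (Suc m)} = {1..Suc m} \<union> {Suc m, Suc (Suc m)}" by auto
      then have "g ` {1..Suc (Suc m)} = g ` {1..Suc m} \<union> {g (Suc m), g (Suc (Suc m))}"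
        by (metis image_Un image_empty image_insert)
      moreover have "conn G {g (Suc m), g (Suc (Suc m))}"
        using cycle_enum_adj_Suc[OF g(1), of "Suc m"] Suc.prems edge by (metis insert_commute)
      moreover have "g (Suc m) \<in> g ` {1..Suc m} \<inter> {g (Suc m), g (Suc (Suc m))}" by auto
      ultimately show ?case using Suc conn_Un[of G "g ` {1..Suc m}"] by (metis Suc_lessD empty_iff)
    qed simp
    have "A - {c} = g ` ({..<n} - {0})"
      using cycle_enum_image[OF g(1)] cycle_enum_eq_iff[OF g(1)] g(2) n by force
    moreover have "{..<n} - {0} = {1..Suc (n - 2)}" using n by auto
    ultimately have 1: "conn G (A - {c})" using path[of "n - 2"] n by auto
    moreover have "g 1 \<in> A - {c}" "g 1 \<in> nbs G (g 0)"
      using cycle_enum_mem[OF g(1), of 1] cycle_enum_eq_iff[OF g(1), of 0 1] cycle_enum_adj_Suc[OF g(1), of 0] g(2) n by auto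
    moreover have "A = (A - {c}) \<union> {g 1, g 0}" using c \<open>g 1 \<in> A - {c}\<close> g(2) by auto
    ultimately show ?thesis using conn_Un[of G "A - {c}" "{g 1, g 0}"] edge by auto
  qed
  have "f 0 \<in> A" using cycle_enum_mem[OF assms(1), of 0] n by simp
  then show ?thesis using minus assms(2) by (auto simp: nsep_def)
qed

text \<open>Deleting the only neighbour of \<open>v\<close>, or any other vertex if it has none,
  would isolate \<open>v\<close>.\<close>

lemma nsep_degree:
  assumes "nsep G A" "3 \<le> card A" "v \<in> A"
  shows "2 \<le> card (nbs G v \<inter> A)"
proof (rule ccontr)
  assume "\<not> 2 \<le> card (nbs G v \<inter> A)"
  moreover have fin: "finite A" using assms(2) card.infinite by force
  ultimately have "card (nbs G v \<inter> A) = 0 \<or> card (nbs G v \<inter> A) = 1" by linarith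
  moreover have "A - {v} \<noteq> {}"
  proof
    assume "A - {v} = {}"
    then have "card A \<le> card {v}" by (intro card_mono) auto
    then show False using assms(2) by simp
  qed
  ultimately obtain w where w: "w \<in> A - {v}" "nbs G v \<inter> A \<subseteq> {w}"
  proof (elim disjE)
    assume "card (nbs G v \<inter> A) = 0" "A - {v} \<noteq> {}"
    then have "nbs G v \<inter> A = {}" using fin by simp
    then show ?thesis using \<open>A - {v} \<noteq> {}\<close> that by blast
  next
    assume "card (nbs G v \<inter> A) = 1"
    then obtain w where "nbs G v \<inter> A = {w}" by (rule card_1_singletonE)
    then show ?thesis using that[of w] nbs_irrefl by blast
  qed
  then have "{v} = A - {w}"
    using assms by (intro connD[of G "A - {w}"]) (auto simp: nsep_def)
  then have "A = {v, w}" using w assms(3) by blast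
  then have "card A \<le> 2" by (simp add: card_insert_if)
  then show False using assms(2) by simp
qed

text \<open>A vertex of \<open>A\<close> has at least two neighbours in \<open>A\<close> and exactly
  two on the cycle, so \<open>A\<close> is closed under adjacency in \<open>B\<close>.\<close>

lemma nsep_in_cycle:
  assumes "cycle_enum G B n f" "nsep G B" "A \<subseteq> B" "nsep G A" "3 \<le> card A"
  shows "A = B"
proof (rule connD[of G B])
  fix v assume v: "v \<in> A"
  have "finite B" by (rule cycle_enum_finite[OF assms(1)])
  have "nbs G v \<inter> A = nbs G v \<inter> B"
    using nsep_degree[OF assms(4,5) v] cycle_enum_card_nbs[OF assms(1), of v] v assms(3) \<open>finite B\<close>
    by (intro card_seteq) auto
  then show "nbs G v \<inter> B \<subseteq> A" by blast
qed (use assms in \<open>auto simp: nsep_def\<close>)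

end

text \<open>A hereditary form of \<^const>\<open>cactus\<close>, which allows for the disconnected graphs that the
  removal of end-blocks produces.\<close>

definition cactoid :: "('a, 'b) pre_digraph \<Rightarrow> bool" where
  "cactoid G \<longleftrightarrow> graph G \<and> (\<forall>A. nsep G A \<and> 3 \<le> card A \<longrightarrow> (\<exists>n. cycle_graph n (G \<restriction> A)))"

lemma cactoid_induce:
  assumes "cactoid G" "B \<subseteq> verts G"
  shows "cactoid (G \<restriction> B)"
  unfolding cactoid_def
proof (intro conjI allI impI; (elim conjE)?)
  show "graph (G \<restriction> B)" using assms graph.graph_induce by (auto simp: cactoid_def)
next
  fix A assume A: "nsep (G \<restriction> B) A" "3 \<le> card A"
  then have "A \<subseteq> B" by (auto simp: nsep_def)
  then have "nsep G A" "(G \<restriction> B) \<restriction> A = G \<restriction> A"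
    using A assms nsep_induce[OF \<open>A \<subseteq> B\<close> assms(2)] by (simp_all add: induce_induce)
  then show "\<exists>n. cycle_graph n ((G \<restriction> B) \<restriction> A)" using A assms by (auto simp: cactoid_def)
qed

text \<open>A larger nonseparable set would also be a cycle, and a cycle contains no smaller
  nonseparable set with three or more vertices.\<close>

lemma cactoid_vblock:
  assumes "cactoid G" "nsep G A" "3 \<le> card A"
  shows "vblock G A"
proof -
  interpret graph G using assms by (simp add: cactoid_def)
  have "A = B" if B: "nsep G B" "A \<subseteq> B" for B
  proof -
    have "finite B" using that(1) finite_subset[of B "verts G"] by (auto simp: nsep_def)
    then have "3 \<le> card B" using assms(3) card_mono[OF _ that(2)] by linarith
    then obtain n where "cycle_graph n (G \<restriction> B)"
      using assms(1) B(1) unfolding cactoid_def by blast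
    then obtain f where "cycle_enum G B n f" by (rule cycle_graph_induceE)
    then show ?thesis using nsep_in_cycle B assms by blast
  qed
  then show ?thesis using assms(2) by (auto simp: vblock_def)
qed

lemma cactus_imp_cactoid:
  assumes "cactus G"
  shows "cactoid G"
proof -
  interpret graph G using assms by (simp add: cactus_def)
  have "\<exists>n. cycle_graph n (G \<restriction> A)" if A: "nsep G A" "3 \<le> card A" for A
  proof -
    obtain B where B: "vblock G B" "A \<subseteq> B" using ex_vblock[OF A(1)] .
    then have nB: "nsep G B" by (simp add: vblock_def)
    have "finite B" using nB finite_subset[of B "verts G"] by (auto simp: nsep_def)
    then have "3 \<le> card B" using A(2) card_mono[OF _ B(2)] by linarith
    then have "\<not> K\<^bsub>2\<^esub> (G \<restriction> B)" by (auto simp: complete_digraph_def)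
    then obtain n where n: "cycle_graph n (G \<restriction> B)" using assms B(1) block_iff unfolding cactus_def by blast
    then obtain f where "cycle_enum G B n f" by (rule cycle_graph_induceE)
    then have "A = B" using nsep_in_cycle nB B(2) A by blast
    then show ?thesis using n by blast
  qed
  then show ?thesis using graph_axioms by (auto simp: cactoid_def)
qed

section \<open>From cactoids back to cacti\<close>

context graph begin

lemma nsep_K2:
  assumes "nsep G A" "card A = 2"
  shows "K\<^bsub>2\<^esub> (G \<restriction> A)"
proof -
  obtain u v where uv: "A = {u, v}" "u \<noteq> v" using assms(2) by (auto simp: card_2_iff)
  have "v \<in> nbs G u"
  proof (rule ccontr)
    assume "v \<notin> nbs G u"
    then have "{u} = A" using assms(1) uv nbs_irrefl by (intro connD[of G A]) (auto simp: nsep_def)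
    then show False using uv by auto
  qed
  moreover have "u \<in> nbs G v" using calculation nbs_sym by blast
  ultimately have "arcs_ends (G \<restriction> A) = {(x, y). (x, y) \<in> A \<times> A \<and> x \<noteq> y}"
  proof (intro set_eqI iffI; clarify)
    fix x y assume "x \<rightarrow>\<^bsub>G \<restriction> A\<^esub> y"
    then have "y \<in> nbs (G \<restriction> A) x" by (simp add: nbs_def)
    then show "(x, y) \<in> A \<times> A \<and> x \<noteq> y" using nbs_irrefl[of x] by (auto simp: nbs_induce split: if_splits)
  next
    fix x y assume "x \<in> A" "y \<in> A" "x \<noteq> y"
    then have "y \<in> nbs (G \<restriction> A) x"
      using \<open>v \<in> nbs G u\<close> \<open>u \<in> nbs G v\<close> uv(1) by (auto simp: nbs_induce)
    then show "x \<rightarrow>\<^bsub>G \<restriction> A\<^esub> y" by (simp add: nbs_def)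
  qed
  moreover have "graph (G \<restriction> A)" using assms(1) by (intro graph_induce) (simp add: nsep_def)
  ultimately show ?thesis using assms(2) by (simp add: complete_digraph_def)
qed

lemma vblock_card_ge_2:
  assumes "vblock G A" "conn G (verts G)" "2 \<le> card (verts G)"
  shows "2 \<le> card A"
proof (rule ccontr)
  assume "\<not> 2 \<le> card A"
  moreover have "finite A" "A \<noteq> {}" using assms(1) finite_subset[of A "verts G"] by (auto simp: vblock_def nsep_def)
  ultimately have "card A = 1" using card_gt_0_iff[of A] by linarith
  then obtain v where v: "A = {v}" by (rule card_1_singletonE)
  then have "v \<in> verts G" using assms(1) by (auto simp: vblock_def nsep_def)
  have "nbs G v \<noteq> {}"
  proof
    assume "nbs G v = {}"
    then have "{v} = verts G" using \<open>v \<in> verts G\<close> by (intro connD[OF assms(2)]) auto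
    then show False using assms(3) by (metis One_nat_def Suc_n_not_le_n is_singletonI is_singleton_altdef numeral_2_eq_2)
  qed
  then obtain u where "u \<in> nbs G v" by blast
  then have "{u, v} = {v}" using nsep_edge[of u v] assms(1) unfolding vblock_def v by blast
  then show False using \<open>u \<in> nbs G v\<close> nbs_irrefl by blast
qed

text \<open>A connected graph with two vertices has no block consisting of a single vertex, the one
  block shape that a cactoid allows and a cactus forbids.\<close>

lemma cactoid_imp_cactus:
  assumes "cactoid G" "conn G (verts G)" "2 \<le> card (verts G)"
  shows "cactus G"
  unfolding cactus_def
proof (intro conjI allI impI)
  show "connected G" using assms(2,3) by (auto simp: connected_iff)
next
  fix B assume "block G B"
  then obtain A where A: "vblock G A" "B = G \<restriction> A" using block_iff by blast
  have "2 \<le> card A" using vblock_card_ge_2 A(1) assms by blast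
  then consider "card A = 2" | "3 \<le> card A" by linarith
  then show "(\<exists>n. cycle_graph n B) \<or> K\<^bsub>2\<^esub> B"
    using nsep_K2[of A] A assms(1) by cases (auto simp: vblock_def cactoid_def)
qed (fact graph_axioms)

end

section \<open>Removing end-blocks\<close>

text \<open>\<open>X\<close> are the vertices owned by Dominator. The attaching vertex \<open>c\<close> need not be a vertex of \<open>G\<close>,
  and it may lie in \<open>K\<close>; then \<open>K\<close> is a union of components.\<close>

definition separated :: "('a, 'b) pre_digraph \<Rightarrow> 'a set \<Rightarrow> 'a set \<Rightarrow> bool" where
  "separated G X K \<longleftrightarrow> K \<noteq> {} \<and> K \<subseteq> verts G \<and> K \<inter> X = {} \<and>
     (\<exists>c. c \<notin> X \<and> (\<forall>v \<in> K. nbs G v \<subseteq> insert c K))"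

text \<open>The end-block condition in terms of neighbourhoods instead of the other blocks; here the
  attaching vertex \<open>c\<close> belongs to \<open>A\<close>.\<close>

definition pendant :: "('a, 'b) pre_digraph \<Rightarrow> 'a set \<Rightarrow> 'a \<Rightarrow> bool" where
  "pendant G A c \<longleftrightarrow> A \<subseteq> verts G \<and> c \<in> A \<and> (\<forall>v \<in> A - {c}. nbs G v \<subseteq> A)"

lemma separatedI:
  "K \<noteq> {} \<Longrightarrow> K \<subseteq> verts G \<Longrightarrow> K \<inter> X = {} \<Longrightarrow> c \<notin> X \<Longrightarrow> (\<And>v. v \<in> K \<Longrightarrow> nbs G v \<subseteq> insert c K)
    \<Longrightarrow> separated G X K"
  unfolding separated_def by blast

text \<open>A minimal separated set, together with its attaching vertex, has no cut vertex.\<close>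

lemma (in graph) minimal_separated:
  assumes "separated G X K0"
  obtains (isolated) v where "v \<in> verts G - X" "nbs G v = {}"
    | (leaf) u v where "v \<in> verts G - X" "u \<in> verts G - X" "nbs G v = {u}"
    | (nsep) A c where "nsep G A" "3 \<le> card A" "A \<inter> X = {}" "pendant G A c"
proof -
  define K where "K = (ARG_MIN card K. separated G X K)"
  have sep: "separated G X K" and min: "\<And>K'. separated G X K' \<Longrightarrow> card K \<le> card K'"
    unfolding K_def using arg_min_nat_lemma[of "separated G X" K0 card] assms by blast+
  have K: "K \<noteq> {}" "K \<subseteq> verts G" "K \<inter> X = {}" using sep by (auto simp: separated_def)
  obtain c where c: "c \<notin> X" "\<And>v. v \<in> K \<Longrightarrow> nbs G v \<subseteq> insert c K"
    using sep unfolding separated_def by blast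
  have fin: "finite K" using finite_subset[OF K(2)] by simp
  have minimal: False if "U \<subseteq> K" "U \<noteq> {}" "U \<noteq> K" "w \<notin> X" "\<And>u. u \<in> U \<Longrightarrow> nbs G u \<subseteq> insert w U" for U w
  proof -
    have "separated G X U" using that K by (intro separatedI[of U G X w]) auto
    moreover have "card U < card K" using that fin by (intro psubset_card_mono) auto
    ultimately show False using min by force
  qed
  show ?thesis
  proof (cases "card K = 1")
    case True
    then obtain v where v: "K = {v}" by (rule card_1_singletonE)
    then have "nbs G v \<subseteq> {c}" using c(2)[of v] nbs_irrefl by blast
    then consider "nbs G v = {}" | "nbs G v = {c}" by blast
    then show ?thesis
    proof cases
      case 1
      then show ?thesis using isolated K v by auto
    next
      case 2
      then have "c \<in> verts G" using nbs_verts by blast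
      then show ?thesis using leaf[OF _ _ 2] K v c(1) by auto
    qed
  next
    case False
    then have card: "2 \<le> card K" using fin K(1) card_gt_0_iff[of K] by linarith
    \<comment> \<open>If \<open>K\<close> were a union of components, deleting any \<open>w\<close>
      from it would leave a smaller separated set, attached at \<open>w\<close>.\<close>
    have open_K: "\<exists>v \<in> K. \<not> nbs G v \<subseteq> K"
    proof (rule ccontr)
      assume "\<not> ?thesis"
      moreover obtain w where w: "w \<in> K" using K by blast
      moreover have "K - {w} \<noteq> {}"
      proof
        assume "K - {w} = {}"
        then have "K = {w}" using w by blast
        then show False using card by simp
      qed
      ultimately show False using K(3) by (intro minimal[of "K - {w}" w]) auto
    qed
    then obtain v where v: "v \<in> K" "c \<in> nbs G v" "c \<notin> K" using c(2) by blast
    let ?A = "insert c K"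
    \<comment> \<open>A part of the remainder away from \<open>c\<close> would hang on
      \<open>w\<close> alone, against the minimality of \<open>K\<close>.\<close>
    have "conn G (?A - {w})" if "w \<notin> X" for w
    proof (rule ccontr)
      assume "\<not> conn G (?A - {w})"
      then obtain U where U: "U \<subseteq> ?A - {w}" "U \<noteq> {}" "U \<noteq> ?A - {w}" "c \<notin> U"
        "\<And>u. u \<in> U \<Longrightarrow> nbs G u \<inter> (?A - {w}) \<subseteq> U" using not_connE[where x = c] by metis
      have "U \<subseteq> K" using U(1,4) by blast
      moreover have "nbs G u \<subseteq> insert w U" if "u \<in> U" for u
        using U(5)[OF that] c(2)[of u] that calculation by blast
      \<comment> \<open>For \<open>w = c\<close> the remainder is \<open>K\<close> itself and
        \<open>U\<close> is a proper part of it; otherwise \<open>v\<close> in \<open>U\<close>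
        would draw its neighbour \<open>c\<close> into \<open>U\<close>.\<close>
      moreover have "U \<noteq> K" using U(3,4) U(5)[of v] v by (cases "w = c") auto
      ultimately show False using minimal[of U w] U(2) \<open>w \<notin> X\<close> by blast
    qed
    moreover have "conn G ?A"
    proof (rule ccontr)
      assume "\<not> conn G ?A"
      then obtain U where U: "U \<subseteq> ?A" "U \<noteq> {}" "U \<noteq> ?A" "c \<notin> U"
        "\<And>u. u \<in> U \<Longrightarrow> nbs G u \<inter> ?A \<subseteq> U" using not_connE[where x = c] by metis
      have "U \<subseteq> K" using U(1,4) by blast
      moreover have "nbs G u \<subseteq> insert c U" if "u \<in> U" for u
        using U(5)[OF that] c(2)[of u] that calculation by blast
      moreover have "U \<noteq> K" using U(4) U(5)[of v] v by blast
      ultimately show False using minimal[of U c] U(2) c(1) by blast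
    qed
    moreover have "?A \<subseteq> verts G" using v K nbs_verts by blast
    ultimately have "nsep G ?A" using c(1) K(3) unfolding nsep_def by blast
    moreover have "3 \<le> card ?A" using card v(3) fin by simp
    moreover have "pendant G ?A c" using \<open>?A \<subseteq> verts G\<close> c(2) by (auto simp: pendant_def)
    ultimately show ?thesis using nsep c(1) K(3) by blast
  qed
qed

text \<open>Another block that meets \<open>A\<close> off \<open>c\<close> stays connected without
  \<open>c\<close>, so it cannot leave \<open>A\<close>. It would then lie inside \<open>A\<close>,
  against its maximality.\<close>

lemma pendant_block:
  assumes "graph G" "pendant G A c" "vblock G A"
  shows "card (verts (G \<restriction> A) \<inter> \<Union> {verts B' | B'. block G B' \<and> B' \<noteq> G \<restriction> A}) \<le> 1"
proof -
  interpret graph G by fact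
  have eq: "v = c" if v: "v \<in> A" "vblock G A'" "v \<in> A'" "G \<restriction> A' \<noteq> G \<restriction> A" for v A'
  proof (rule ccontr)
    assume "v \<noteq> c"
    have "conn G (A' - {c})" using v(2) by (cases "c \<in> A'") (auto simp: vblock_def nsep_def)
    then have "A \<inter> A' - {c} = A' - {c}"
      using v \<open>v \<noteq> c\<close> assms(2) by (intro connD[of G "A' - {c}"]) (auto simp: pendant_def)
    then have "A' \<subseteq> A" using assms(2) by (auto simp: pendant_def)
    then show False using v assms(3) by (auto simp: vblock_def)
  qed
  have "verts (G \<restriction> A) \<inter> \<Union> {verts B' | B'. block G B' \<and> B' \<noteq> G \<restriction> A} \<subseteq> {c}"
    unfolding block_iff using eq by auto
  then show ?thesis using card_mono[of "{c}"] by fastforce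
qed

lemma remove_end_C4I:
  assumes "graph G" "pendant G A c" "vblock G A" "cycle_graph 4 (G \<restriction> A)"
  shows "remove_end_C4 G (G \<restriction> (verts G - A))"
proof -
  have "end_block G (G \<restriction> A)"
    using pendant_block[OF assms(1-3)] assms graph.block_iff[OF assms(1)] by (auto simp: end_block_def)
  then show ?thesis using assms(4) by (auto simp: remove_end_C4_def)
qed

text \<open>Every edge lies in a block, so a vertex of \<open>A\<close> that is in no other block
  has all its neighbours in \<open>A\<close>.\<close>

lemma remove_end_C4E:
  assumes "graph G" "remove_end_C4 G G'"
  obtains A f where "cycle_enum G A 4 f" "pendant G A (f 0)" "cycle_graph 4 (G \<restriction> A)"
    "G' = G \<restriction> (verts G - A)"
proof -
  interpret graph G by fact
  obtain A where A: "vblock G A" "cycle_graph 4 (G \<restriction> A)" "G' = G \<restriction> (verts G - A)"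
    "card (A \<inter> \<Union> {verts B' | B'. block G B' \<and> B' \<noteq> G \<restriction> A}) \<le> 1" (is "card ?I \<le> 1")
    using assms(2) by (auto simp: remove_end_C4_def end_block_def block_iff)
  obtain g where g: "cycle_enum G A 4 g" using cycle_graph_induceE[OF A(2)] .
  have AG: "A \<subseteq> verts G" "A \<noteq> {}" using A(1) by (auto simp: vblock_def nsep_def)
  \<comment> \<open>If no other block meets \<open>A\<close>, an arbitrary vertex of
    \<open>A\<close> acts as the attaching one.\<close>
  have "\<exists>c \<in> A. ?I \<subseteq> {c}"
  proof (cases "?I = {}")
    case False
    moreover have "finite ?I" using cycle_enum_finite[OF g] by blast
    ultimately have "card ?I = 1" using A(4) card_gt_0_iff[of ?I] by linarith
    then obtain c where "?I = {c}" by (rule card_1_singletonE)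
    then show ?thesis by blast
  qed (use AG in blast)
  then obtain c where c: "c \<in> A" "?I \<subseteq> {c}" by blast
  have "nbs G v \<subseteq> A" if v: "v \<in> A - {c}" for v
  proof
    fix u assume u: "u \<in> nbs G v"
    obtain A' where A': "vblock G A'" "{u, v} \<subseteq> A'" using ex_vblock[OF nsep_edge[OF u]] .
    have "A' = A"
    proof (rule ccontr)
      assume "A' \<noteq> A"
      then have "G \<restriction> A' \<noteq> G \<restriction> A" using induce_subgraph_verts by metis
      then have "v \<in> ?I" using v A' block_iff by fastforce
      then show False using c(2) v by blast
    qed
    then show "u \<in> A" using A' by blast
  qed
  then have "pendant G A c" using AG c by (auto simp: pendant_def)
  moreover obtain f where "cycle_enum G A 4 f" "f 0 = c" using cycle_enum_start[OF g c(1)] .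
  ultimately show ?thesis using that A by blast
qed

lemma pendant_nbs:
  assumes "cycle_enum G A n f" "pendant G A (f 0)" "0 < i" "i < n"
  shows "nbs G (f i) = {f (if Suc i = n then 0 else Suc i), f (i - 1)}"
proof -
  have "f i \<noteq> f 0" using cycle_enum_eq_iff[OF assms(1,4), of 0] assms(3,4) by auto
  then have "nbs G (f i) \<inter> A = nbs G (f i)"
    using assms(2) cycle_enum_mem[OF assms(1,4)] by (auto simp: pendant_def)
  then show ?thesis using cycle_enum_nbs[OF assms(1,4)] assms(3) by simp
qed

text \<open>Staller's \<open>f 0\<close> threatens to complete the neighbourhood
  \<open>{f 2, f 0}\<close> of \<open>f 1\<close>. After the forced answer \<open>f 2\<close>, the
  vertices \<open>f 1\<close> and \<open>f 3\<close> form a pair that can be set aside by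
  \<open>dwin_drop_pair\<close>.\<close>

lemma dwin_remove_end_C4:
  assumes "graph G" "cycle_enum G A 4 f" "pendant G A (f 0)" "A \<inter> X = {}"
    and win: "dwin (nbhds G) Staller {} (verts G - X)"
  shows "dwin (nbhds (G \<restriction> (verts G - A))) Staller {} (verts G - A - X)"
proof -
  interpret graph G by fact
  have A: "A = {f 0, f 1, f 2, f 3}"
    using cycle_enum_image[OF assms(2)] by (auto simp: lessThan_nat_numeral lessThan_Suc)
  have AG: "A \<subseteq> verts G" using assms(3) by (simp add: pendant_def)
  have ne: "f i \<noteq> f j" if "i < 4" "j < 4" "i \<noteq> j" for i j using that cycle_enum_eq_iff[OF assms(2)] by blast
  have "nbs G (f 1) = {f 2, f 0}" using pendant_nbs[OF assms(2,3), of 1] by (simp add: numeral_2_eq_2)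
  then have "dwin (nbhds G) Staller {f 0} (verts G - X - {f 0, f 2})"
    using A AG assms(4) ne[of 0 2] by (intro dwin_forced[OF win, of _ _ "nbs G (f 1)"]) auto
  moreover have "verts G - X - {f 0, f 2} = insert (f 1) (insert (f 3) (verts G - A - X))"
  proof -
    have *: "V - X - {a, c} = insert b (insert d (V - {a, b, c, d} - X))"
      if "b \<in> V - X - {a, c}" "d \<in> V - X - {a, c}" for V and a b c d :: 'a using that by auto
    have "f 1 \<in> verts G - X - {f 0, f 2}" "f 3 \<in> verts G - X - {f 0, f 2}"
      using A AG assms(4) ne[of 1 0] ne[of 3 0] ne[of 1 2] ne[of 3 2] by auto
    then show ?thesis unfolding A by (rule *)
  qed
  ultimately have "dwin (nbhds G) Staller {f 0} (verts G - A - X)"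
    by (rule dwin_drop_pair) (use ne[of 1 3] in \<open>simp_all add: A\<close>)
  \<comment> \<open>Of the deleted vertices only \<open>f 0\<close> can have neighbours outside
    \<open>A\<close>, and Staller owns it. So the neighbourhoods in the smaller graph are just what
    she still has to collect.\<close>
  then show ?thesis
  proof (rule dwin_mono)
    fix e' assume "e' \<in> nbhds (G \<restriction> (verts G - A))"
    then obtain v where v: "v \<in> verts G - A" "e' = nbs G v \<inter> (verts G - A)" by (auto simp: nbs_induce)
    have "u \<notin> A - {f 0}" if "u \<in> nbs G v" for u
      using that v(1) nbs_sym[of u v] assms(3) by (auto simp: pendant_def)
    then have "nbs G v - {f 0} \<subseteq> e' - {}" using v(2) nbs_verts[of v] by blast
    then show "\<exists>e \<in> nbhds G. e - {f 0} \<subseteq> e' - {}" using v(1) by blast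
  qed
qed

text \<open>Every removed block avoids \<open>X\<close>, so Dominator's vertices survive into
  \<open>H\<close>, where the reduction has come to a halt.\<close>

lemma reduce_end_C4:
  assumes "cactoid G" "X \<subseteq> verts G" "dwin (nbhds G) Staller {} (verts G - X)"
  shows "\<exists>H. remove_end_C4\<^sup>*\<^sup>* G H \<and> cactoid H \<and> X \<subseteq> verts H \<and>
    dwin (nbhds H) Staller {} (verts H - X) \<and> (\<forall>K. \<not> separated H X K)"
  using assms
proof (induction "card (verts G)" arbitrary: G rule: less_induct)
  case less
  interpret graph G using less.prems(1) by (simp add: cactoid_def)
  note win = less.prems(3)
  show ?case
  proof (cases "\<exists>K. separated G X K")
    case False
    then show ?thesis using less.prems by blast
  next
    case True
    then obtain K where "separated G X K" by blast
    then show ?thesis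
    proof (cases rule: minimal_separated)
      case (isolated v)
      then show ?thesis using dwin_not_claimed[OF win, of "{}"] by force
    next
      case (leaf u v)
      then show ?thesis using dwin_no_threat[OF win, of u "{u}"] by force
    next
      case (nsep A c)
      have AG: "A \<subseteq> verts G" using nsep(4) by (simp add: pendant_def)
      obtain n where n: "cycle_graph n (G \<restriction> A)" using less.prems(1) nsep by (auto simp: cactoid_def)
      obtain f0 where "cycle_enum G A n f0" using cycle_graph_induceE[OF n] .
      then obtain f where f: "cycle_enum G A n f" "f 0 = c"
        using cycle_enum_start nsep(4) unfolding pendant_def by metis
      have pend: "pendant G A (f 0)" using f nsep(4) by simp
      have mem: "f i \<in> verts G - X" "f i \<in> verts G" if "i < n" for i
        using cycle_enum_mem[OF f(1) that] AG nsep(3) by auto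
      have ne: "f i \<noteq> f j" if "i < n" "j < n" "i \<noteq> j" for i j using that cycle_enum_eq_iff[OF f(1)] by blast
      consider "n = 3" | "n = 4" | "5 \<le> n" using f(1) by (auto simp: cycle_enum_def; linarith)
      then show ?thesis
      proof cases
        case 1
        \<comment> \<open>In a triangle the fork is at the attaching vertex \<open>f 0\<close>: the
          neighbourhoods of \<open>f 1\<close> and \<open>f 2\<close> then lack only
          \<open>f 2\<close> and \<open>f 1\<close>.\<close>
        have "nbs G (f 1) = {f 2, f 0}" "nbs G (f 2) = {f 0, f 1}"
          using pendant_nbs[OF f(1) pend, of 1] pendant_nbs[OF f(1) pend, of 2] 1 by (simp_all add: numeral_2_eq_2)
        then have False
          by (intro dwin_no_double_threat[OF win mem(1) mem(1) mem(1) _ imageI[OF mem(2)] _ imageI[OF mem(2)],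
                of 0 2 1 1 2]) (use ne[of 0 1] ne[of 0 2] ne[of 1 2] 1 in auto)
        then show ?thesis ..
      next
        case 3
        \<comment> \<open>The fork is at \<open>f 2\<close>, with threats \<open>f 0\<close> and
          \<open>f 4\<close> against the vertices \<open>f 1\<close> and \<open>f 3\<close>.\<close>
        have "nbs G (f 1) = {f 2, f 0}" "nbs G (f 3) = {f 4, f 2}"
          using pendant_nbs[OF f(1) pend, of 1] pendant_nbs[OF f(1) pend, of 3] 3
          by (simp_all add: numeral_eq_Suc)
        then have False
          by (intro dwin_no_double_threat[OF win mem(1) mem(1) mem(1) _ imageI[OF mem(2)] _ imageI[OF mem(2)],
                of 2 0 4 1 3]) (use ne[of 0 2] ne[of 0 4] ne[of 2 4] 3 in auto)
        then show ?thesis ..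
      next
        case 2
        let ?G = "G \<restriction> (verts G - A)"
        have step: "remove_end_C4 G ?G"
          using remove_end_C4I[OF graph_axioms nsep(4)] cactoid_vblock[OF less.prems(1) nsep(1,2)] n 2 by blast
        have "card (verts ?G) < card (verts G)"
          using AG nsep(4) by (intro psubset_card_mono) (auto simp: pendant_def)
        moreover have "cactoid ?G" using less.prems(1) by (rule cactoid_induce) blast
        moreover have "X \<subseteq> verts ?G" using less.prems(2) nsep(3) by auto
        moreover have "dwin (nbhds ?G) Staller {} (verts ?G - X)"
          using dwin_remove_end_C4[OF graph_axioms _ _ nsep(3) win] f(1) pend 2 by auto
        ultimately obtain H where "remove_end_C4\<^sup>*\<^sup>* ?G H" "cactoid H" "X \<subseteq> verts H"
          "dwin (nbhds H) Staller {} (verts H - X)" "\<forall>K. \<not> separated H X K"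
          using less.hyps[of ?G] by blast
        then show ?thesis using step by (meson converse_rtranclp_into_rtranclp)
      qed
    qed
  qed
qed

section \<open>Graphs whose blocks share a vertex\<close>

text \<open>Anything that one vertex other than \<open>x\<close> cuts off from \<open>x\<close>
  would be separated. For a block \<open>A\<close> without \<open>x\<close>, the component of the
  graph minus \<open>x\<close> that meets \<open>A\<close>, enlarged by \<open>x\<close>, would
  therefore be nonseparable and larger than \<open>A\<close>.\<close>

lemma (in graph) not_separated_imp_centre:
  assumes "x \<in> verts G" "\<And>K. \<not> separated G {x} K"
  shows "conn G (verts G)" and "vblock G A \<Longrightarrow> x \<in> A"
proof -
  have no_cut: "conn G (B - {w})"
    if B: "x \<in> B" "B \<subseteq> verts G" "\<And>v. v \<in> B \<Longrightarrow> v \<noteq> x \<Longrightarrow> nbs G v \<subseteq> B" and w: "w \<noteq> x" for B w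
  proof (rule ccontr)
    assume "\<not> conn G (B - {w})"
    then obtain U where U: "U \<subseteq> B - {w}" "U \<noteq> {}" "x \<notin> U"
      "\<And>u. u \<in> U \<Longrightarrow> nbs G u \<inter> (B - {w}) \<subseteq> U" using not_connE[where x = x] by metis
    have "nbs G u \<subseteq> insert w U" if "u \<in> U" for u
      using U(1) U(4)[OF that] B(3)[of u] U(3) that by blast
    then have "separated G {x} U" using U B(2) w by (intro separatedI[of U G "{x}" w]) auto
    then show False using assms(2) by blast
  qed
  have whole: "conn G B"
    if B: "x \<in> B" "B \<subseteq> verts G" "\<And>v. v \<in> B \<Longrightarrow> v \<noteq> x \<Longrightarrow> nbs G v \<subseteq> B" for B
  proof (rule ccontr)
    assume "\<not> conn G B"
    then obtain U where U: "U \<subseteq> B" "U \<noteq> {}" "x \<notin> U"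
      "\<And>u. u \<in> U \<Longrightarrow> nbs G u \<inter> B \<subseteq> U" using not_connE[where x = x] by metis
    \<comment> \<open>\<open>U\<close> is closed, so any vertex may be named as attaching; taking it
      from \<open>U\<close> keeps it different from \<open>x\<close>.\<close>
    then obtain w where "w \<in> U" by blast
    have "nbs G u \<subseteq> insert w U" if "u \<in> U" for u
      using U(1) U(4)[OF that] B(3)[of u] U(3) that by blast
    then have "separated G {x} U" using U B(2) \<open>w \<in> U\<close> by (intro separatedI[of U G "{x}" w]) auto
    then show False using assms(2) by blast
  qed
  show "conn G (verts G)" using assms(1) nbs_verts by (intro whole) auto
  show "x \<in> A" if A: "vblock G A"
  proof (rule ccontr)
    assume x: "x \<notin> A"
    have nA: "nsep G A" using A by (simp add: vblock_def)
    \<comment> \<open>A smallest such set is a component of the graph minus \<open>x\<close> that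
      meets \<open>A\<close>.\<close>
    define good where "good Q \<longleftrightarrow> Q \<subseteq> verts G - {x} \<and> Q \<inter> A \<noteq> {} \<and> (\<forall>v \<in> Q. nbs G v \<subseteq> insert x Q)" for Q
    have "good (verts G - {x})" using nA x nbs_verts by (auto simp: good_def nsep_def)
    define Q where "Q = (ARG_MIN card Q. good Q)"
    have Q: "good Q" and min: "\<And>Q'. good Q' \<Longrightarrow> card Q \<le> card Q'"
      unfolding Q_def using arg_min_nat_lemma[of good "verts G - {x}" card] \<open>good (verts G - {x})\<close> by blast+
    have fin: "finite Q" using Q finite_subset[of Q "verts G"] by (auto simp: good_def)
    obtain a where a: "a \<in> Q \<inter> A" using Q by (auto simp: good_def)
    have "conn G Q"
    proof (rule ccontr)
      assume "\<not> conn G Q"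
      then obtain U where U: "U \<subseteq> Q" "U \<noteq> {}" "a \<notin> U"
        "\<And>u. u \<in> U \<Longrightarrow> nbs G u \<inter> Q \<subseteq> U" using not_connE[where x = a] by metis
      have "nbs G v \<subseteq> insert x (Q - U)" if "v \<in> Q - U" for v
        using U(4) nbs_sym Q that unfolding good_def by blast
      then have "good (Q - U)" using Q a U(3) by (auto simp: good_def)
      moreover have "card (Q - U) < card Q" using fin U by (intro psubset_card_mono) auto
      ultimately show False using min by force
    qed
    let ?B = "insert x Q"
    have "A \<inter> Q = A"
      using nA a Q x by (intro connD[of G A]) (auto simp: nsep_def good_def)
    have nbsB: "\<And>v. v \<in> ?B \<Longrightarrow> v \<noteq> x \<Longrightarrow> nbs G v \<subseteq> ?B" and "x \<in> ?B" "?B \<subseteq> verts G"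
      using Q assms(1) by (auto simp: good_def)
    then have "conn G ?B" "\<And>w. w \<noteq> x \<Longrightarrow> conn G (?B - {w})"
      using whole[of ?B] no_cut[of ?B] by blast+
    moreover have "?B - {x} = Q" using Q by (auto simp: good_def)
    then have "conn G (?B - {x})" using \<open>conn G Q\<close> by (simp only:)
    ultimately have "conn G ?B" "conn G (?B - {w})" for w by (cases "w = x"; simp only:)+
    then have "nsep G ?B" using \<open>?B \<subseteq> verts G\<close> by (simp only: nsep_def) simp
    then have "?B = A" using A \<open>A \<inter> Q = A\<close> unfolding vblock_def by blast
    then show False using x by blast
  qed
qed

text \<open>The graphs at which the reduction stops after Dominator's first move \<open>x\<close>.
  The same locale later describes N-star cacti, with \<open>x\<close> their common vertex.\<close>

locale star_graph = graph +
  fixes x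
  assumes cactoid: "cactoid G"
    and conn: "conn G (verts G)"
    and centre_verts: "x \<in> verts G"
    and centre: "vblock G A \<Longrightarrow> x \<in> A"
begin

lemma block_pendant:
  assumes "vblock G A"
  shows "pendant G A x"
proof -
  have "u \<in> A" if v: "v \<in> A" "v \<noteq> x" and u: "u \<in> nbs G v" for u v
  proof -
    obtain A' where A': "vblock G A'" "{u, v} \<subseteq> A'" using ex_vblock[OF nsep_edge[OF u]] .
    then have "A' = A" using vblock_eqI[OF A'(1) assms, of x v] centre v A' assms by blast
    then show ?thesis using A' by blast
  qed
  then show ?thesis using assms centre by (auto simp: pendant_def vblock_def nsep_def)
qed

lemma block_Int:
  assumes "vblock G A" "vblock G B" "A \<noteq> B" "v \<in> A" "v \<in> B"
  shows "v = x"
  using vblock_eqI[OF assms(1,2), of x v] centre assms by blast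

lemma ex_block:
  assumes "v \<in> verts G"
  obtains A where "vblock G A" "v \<in> A"
  using ex_vblock[OF nsep_singleton[OF assms]] by blast

lemma cycle_block:
  assumes "vblock G A" "3 \<le> card A"
  obtains f where "cycle_enum G A (card A) f" "f 0 = x" "pendant G A (f 0)" "cycle_graph (card A) (G \<restriction> A)"
proof -
  obtain n where n: "cycle_graph n (G \<restriction> A)"
    using assms cactoid unfolding cactoid_def vblock_def by blast
  then obtain g where g: "cycle_enum G A n g" by (rule cycle_graph_induceE)
  moreover obtain f where "cycle_enum G A n f" "f 0 = x" using cycle_enum_start[OF g centre[OF assms(1)]] .
  ultimately show ?thesis using that n block_pendant[OF assms(1)] cycle_enum_card[OF g] by auto
qed

lemma pair_block:
  assumes "vblock G A" "card A = 2"
  obtains v where "A = {x, v}" "v \<noteq> x" "v \<in> nbs G x"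
proof -
  obtain v where v: "A = {x, v}" "v \<noteq> x"
    using assms(2) centre[OF assms(1)] by (auto simp: card_2_iff doubleton_eq_iff)
  have "K\<^bsub>2\<^esub> (G \<restriction> A)" using nsep_K2 assms by (auto simp: vblock_def)
  then have "v \<in> nbs (G \<restriction> A) x" using v by (auto simp: complete_digraph_def nbs_def)
  then show ?thesis using that v by (auto simp: nbs_induce split: if_splits)
qed

text \<open>Dominator owns \<open>x = f 0\<close>, so the fork has to avoid it: Staller takes
  \<open>f 3\<close> and threatens \<open>f 1\<close> and \<open>f 5\<close>. In a 5-cycle the
  latter would be \<open>x\<close>.\<close>

lemma block_size:
  assumes "dwin (nbhds G) Staller {} (verts G - {x})" "vblock G A"
  shows "card A \<le> 5"
proof (rule ccontr)
  assume "\<not> card A \<le> 5"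
  then have n: "6 \<le> card A" "3 \<le> card A" by simp_all
  obtain f where f: "cycle_enum G A (card A) f" "f 0 = x" "pendant G A (f 0)"
    using cycle_block[OF assms(2) n(2)] by blast
  have AG: "A \<subseteq> verts G" using f(3) by (simp add: pendant_def)
  have mem: "f i \<in> verts G - {x}" "f i \<in> verts G" if "0 < i" "i < card A" for i
    using cycle_enum_mem[OF f(1) that(2)] AG f(2) cycle_enum_eq_iff[OF f(1) that(2), of 0] that by auto
  have ne: "f i \<noteq> f j" if "i < card A" "j < card A" "i \<noteq> j" for i j
    using that cycle_enum_eq_iff[OF f(1)] by blast
  have "nbs G (f 2) = {f 3, f 1}" "nbs G (f 4) = {f 5, f 3}"
    using pendant_nbs[OF f(1,3), of 2] pendant_nbs[OF f(1,3), of 4] n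
    by (simp_all add: numeral_eq_Suc)
  then show False
    by (intro dwin_no_double_threat[OF assms(1) mem(1) mem(1) mem(1) _ imageI[OF mem(2)] _ imageI[OF mem(2)],
          of 3 1 5 2 4]) (use ne[of 3 1] ne[of 3 5] ne[of 1 5] n in auto)
qed

text \<open>In a 5-cycle \<open>x, f 1, \<dots>, f 4\<close>, taking \<open>f 1\<close> and then \<open>f 4\<close> forces Dominator to answer with \<open>f 3\<close>
  and \<open>f 2\<close>, so that Staller gets all neighbours of \<open>x\<close> in the block.\<close>

lemma force_5_blocks:
  assumes win: "dwin (nbhds G) Staller {} (verts G - {x})"
    and "finite \<A>" "\<And>A. A \<in> \<A> \<Longrightarrow> vblock G A \<and> card A = 5"
  shows "dwin (nbhds G) Staller (\<Union>A \<in> \<A>. nbs G x \<inter> A) (verts G - {x} - \<Union>\<A>)"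
  using assms(2,3)
proof (induction \<A> rule: finite_induct)
  case (insert A \<A>)
  let ?S = "\<Union>A \<in> \<A>. nbs G x \<inter> A" and ?F = "verts G - {x} - \<Union>\<A>"
  have IH: "dwin (nbhds G) Staller ?S ?F" using insert by blast
  have A: "vblock G A" "card A = 5" using insert.prems by auto
  obtain f where f: "cycle_enum G A 5 f" "f 0 = x" "pendant G A (f 0)"
    using cycle_block[OF A(1)] A(2) by auto
  have AG: "A \<subseteq> verts G" using f(3) by (simp add: pendant_def)
  have nx: "f i \<noteq> x" if "0 < i" "i < 5" for i
    using f(2) cycle_enum_eq_iff[OF f(1) that(2), of 0] that by auto
  \<comment> \<open>Distinct blocks meet only in \<open>x\<close>, so the rounds played in other
    5-cycles have not touched \<open>A - {x}\<close>.\<close>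
  have mem: "f i \<in> ?F" "f i \<in> verts G" if i: "0 < i" "i < 5" for i
  proof -
    have "f i \<notin> B" if "B \<in> \<A>" for B
      using block_Int[OF A(1), of B "f i"] insert.prems insert.hyps(2) that cycle_enum_mem[OF f(1) i(2)] nx[OF i]
      by blast
    then show "f i \<in> ?F" "f i \<in> verts G" using cycle_enum_mem[OF f(1) i(2)] AG nx[OF i] by auto
  qed
  have ne: "f i \<noteq> f j" if "i < 5" "j < 5" "i \<noteq> j" for i j
    using that cycle_enum_eq_iff[OF f(1)] by blast
  have nb: "nbs G (f 2) = {f 3, f 1}" "nbs G (f 3) = {f 4, f 2}"
    using pendant_nbs[OF f(1,3), of 2] pendant_nbs[OF f(1,3), of 3] by (simp_all add: numeral_eq_Suc)
  have "dwin (nbhds G) Staller (insert (f 1) ?S) (?F - {f 1, f 3})"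
    by (rule dwin_forced[OF IH mem(1) mem(1) _ imageI[OF mem(2)[of 2]]]) (use nb ne[of 1 3] in auto)
  then have "dwin (nbhds G) Staller (insert (f 4) (insert (f 1) ?S)) (?F - {f 1, f 3} - {f 4, f 2})"
    by (rule dwin_forced[OF _ _ _ _ imageI[OF mem(2)[of 3]]])
      (use nb mem(1)[of 4] mem(1)[of 2] ne[of 4 1] ne[of 4 3] ne[of 2 1] ne[of 2 3] ne[of 4 2] in auto)
  moreover have "nbs G x \<inter> A = {f 1, f 4}" using cycle_enum_nbs[OF f(1), of 0] f(2) by simp
  moreover have "A = {x, f 1, f 2, f 3, f 4}"
    using cycle_enum_image[OF f(1)] f(2) by (auto simp: lessThan_nat_numeral lessThan_Suc)
  then have "?F - {f 1, f 3} - {f 4, f 2} = verts G - {x} - \<Union>(insert A \<A>)" by auto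
  ultimately show ?case by (simp add: insert_commute)
qed (use win in simp)

text \<open>Otherwise the neighbours of \<open>x\<close> lie in 5-cycles, apart from at most one
  leaf. Staller collects those in 5-cycles while every answer is forced, then takes the leaf and
  owns the neighbourhood of \<open>x\<close>.\<close>

lemma centre_dominated:
  assumes win: "dwin (nbhds G) Staller {} (verts G - {x})"
  shows "(\<exists>A. vblock G A \<and> (card A = 3 \<or> card A = 4)) \<or>
    (\<exists>A B. vblock G A \<and> vblock G B \<and> A \<noteq> B \<and> card A = 2 \<and> card B = 2)"
proof (rule ccontr)
  assume contra: "\<not> ?thesis"
  let ?\<A> = "{A. vblock G A \<and> card A = 5}"
  have fin: "finite (verts G)" by simp
  have "finite ?\<A>" by (rule finite_subset[of _ "Pow (verts G)"]) (auto simp: vblock_def nsep_def)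
  from force_5_blocks[OF win this]
  have forced: "dwin (nbhds G) Staller (\<Union>A \<in> ?\<A>. nbs G x \<inter> A) (verts G - {x} - \<Union>?\<A>)" (is "dwin _ _ ?S ?F")
    by blast
  have nb: "u \<in> ?S \<or> (\<exists>A. vblock G A \<and> A = {x, u} \<and> card A = 2)" if u: "u \<in> nbs G x" for u
  proof -
    obtain A where A: "vblock G A" "{u, x} \<subseteq> A" using ex_vblock[OF nsep_edge[OF u]] .
    have "finite A" using A(1) finite_subset[OF _ fin] by (auto simp: vblock_def nsep_def)
    moreover have "card {u, x} = 2" using nbs_irrefl u by (auto simp: card_insert_if)
    ultimately have "2 \<le> card A" using card_mono[OF _ A(2)] by simp
    moreover have "card A \<le> 5" using block_size[OF win A(1)] .
    moreover have "card A \<noteq> 3" "card A \<noteq> 4" using contra A(1) by blast+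
    ultimately consider "card A = 5" | "card A = 2" by linarith
    then show ?thesis
    proof cases
      case 1
      then show ?thesis using A u by blast
    next
      case 2
      then have "{u, x} = A" using A(2) \<open>finite A\<close> \<open>card {u, x} = 2\<close> by (intro card_subset_eq) auto
      then show ?thesis using A 2 by (metis insert_commute)
    qed
  qed
  show False
  proof (cases "nbs G x \<subseteq> ?S")
    case True
    then show False using dwin_not_claimed[OF forced imageI[OF centre_verts]] by blast
  next
    case False
    then obtain l where l: "l \<in> nbs G x" "l \<notin> ?S" by blast
    then obtain A where A: "vblock G A" "A = {x, l}" "card A = 2" using nb by blast
    have "nbs G x \<subseteq> insert l ?S"
    proof
      fix u assume u: "u \<in> nbs G x"
      consider "u \<in> ?S" | B where "vblock G B" "B = {x, u}" "card B = 2" using nb[OF u] by blast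
      then show "u \<in> insert l ?S"
      proof cases
        case 2
        then have "B = A" using contra A by blast
        then have "{x, u} = {x, l}" using A(2) 2(2) by simp
          then show ?thesis using u nbs_irrefl[of x] by (auto simp: doubleton_eq_iff)
      qed blast
    qed
    moreover have "l \<in> ?F" using l nbs_verts nbs_irrefl block_Int[OF A(1)] A by fastforce
    ultimately show False using dwin_no_threat[OF forced _ imageI[OF centre_verts]] by blast
  qed
qed

end

context star_graph begin

text \<open>A neighbour of \<open>x\<close> in the block has degree at most 2, so a Staller move at
  \<open>x\<close> creates a threat in every block.\<close>

lemma block_threat:
  assumes "vblock G A" "2 \<le> card A"
  obtains v y where "v \<in> A - {x}" "y \<in> A - {x}" "nbs G v \<subseteq> {x, y}"
proof (cases "card A = 2")
  case True
  then obtain v where v: "A = {x, v}" "v \<noteq> x" using pair_block[OF assms(1)] by metis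
  then have "nbs G v \<subseteq> {x, v}" using block_pendant[OF assms(1)] by (auto simp: pendant_def)
  \<comment> \<open>For a leaf \<open>v\<close> the neighbourhood is just \<open>{x}\<close>;
    \<open>y = v\<close> fits the common form.\<close>
  then show ?thesis using that[of v v] v by simp
next
  case False
  then have n: "3 \<le> card A" using assms(2) by linarith
  obtain f where f: "cycle_enum G A (card A) f" "f 0 = x" "pendant G A (f 0)"
    using cycle_block[OF assms(1) n] by blast
  have "f i \<in> A - {x}" if "0 < i" "i < 3" for i
    using f(2) cycle_enum_mem[OF f(1), of i] cycle_enum_eq_iff[OF f(1), of i 0] that n by auto
  moreover have "nbs G (f 1) = {f 2, x}"
    using pendant_nbs[OF f(1,3), of 1] n f(2) by (simp add: numeral_2_eq_2)
  ultimately show ?thesis using that[of "f 1" "f 2"] by auto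
qed

text \<open>Staller takes \<open>x\<close>, and the threats in the two blocks concern different
  vertices because the blocks share only \<open>x\<close>.\<close>

lemma Staller_wins_two_blocks:
  assumes "vblock G A" "vblock G B" "A \<noteq> B"
  shows "\<not> dwin (nbhds G) Staller {} (verts G)"
proof
  assume win: "dwin (nbhds G) Staller {} (verts G)"
  have AB: "A \<subseteq> verts G" "B \<subseteq> verts G" using assms by (auto simp: vblock_def nsep_def)
  have "2 \<le> card (verts G)"
  proof (rule ccontr)
    assume "\<not> 2 \<le> card (verts G)"
    then have "card (verts G) \<le> card {x}" by simp
    then have "{x} = verts G" using centre_verts by (intro card_seteq) auto
    then have "A = {x}" "B = {x}" using AB centre[OF assms(1)] centre[OF assms(2)] by auto
    then show False using assms(3) by simp
  qed
  then have "2 \<le> card A" "2 \<le> card B" using vblock_card_ge_2 assms conn by auto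
  obtain v y where v: "v \<in> A - {x}" "y \<in> A - {x}" "nbs G v \<subseteq> {x, y}"
    using block_threat[OF assms(1) \<open>2 \<le> card A\<close>] .
  obtain w z where w: "w \<in> B - {x}" "z \<in> B - {x}" "nbs G w \<subseteq> {x, z}"
    using block_threat[OF assms(2) \<open>2 \<le> card B\<close>] .
  have "y \<noteq> z" using block_Int[OF assms, of y] v w by blast
  then show False
    using v w AB by (intro dwin_no_double_threat[OF win centre_verts, of y z "nbs G v" "nbs G w"]) auto
qed

text \<open>The pairs dominate what \<open>x\<close> does not. In a 3- or 4-cycle the pair consists
  of the neighbours of \<open>x\<close> and so dominates \<open>x\<close> too. In a
  \<open>K\<^sub>2\<close> block the leaf stays unpaired, free to be matched with a leaf of another
  block.\<close>

lemma block_pairs: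
  assumes "vblock G A" "card A \<le> 5"
  shows "\<exists>Q. disjoint Q \<and> (\<forall>p \<in> Q. card p = 2 \<and> p \<subseteq> A - {x}) \<and>
    (\<forall>v \<in> A - {x}. x \<in> nbs G v \<or> (\<exists>p \<in> Q. p \<subseteq> nbs G v)) \<and>
    (card A = 3 \<or> card A = 4 \<longrightarrow> (\<exists>p \<in> Q. p \<subseteq> nbs G x)) \<and> (card A = 2 \<longrightarrow> Q = {})"
proof -
  have "finite A" using assms(1) finite_subset[of A "verts G"] by (auto simp: vblock_def nsep_def)
  then have "0 < card A" using centre[OF assms(1)] card_gt_0_iff by blast
  then consider "card A = 1" | "card A = 2" | "card A = 3" | "card A = 4" | "card A = 5"
    using assms(2) by linarith
  then show ?thesis
  proof cases
    case 1
    then have "A = {x}" using centre[OF assms(1)] by (metis card_1_singletonE singletonD)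
    then show ?thesis using 1 by (intro exI[of _ "{}"]) simp
  next
    case 2
    then obtain v where "A = {x, v}" "v \<noteq> x" "v \<in> nbs G x" using pair_block[OF assms(1)] by blast
    then show ?thesis using 2 nbs_sym[of x v] by (intro exI[of _ "{}"]) auto
  next
    case 3
    then obtain f where f: "cycle_enum G A 3 f" "f 0 = x" using cycle_block[OF assms(1)] by auto
    have A: "A = {x, f 1, f 2}"
      using cycle_enum_image[OF f(1)] f(2) by (auto simp: lessThan_nat_numeral lessThan_Suc)
    have "nbs G x \<inter> A = {f 1, f 2}" using cycle_enum_nbs[OF f(1), of 0] f(2) by simp
    moreover have "f 1 \<noteq> f 2" "f 1 \<noteq> x" "f 2 \<noteq> x"
      using cycle_enum_eq_iff[OF f(1), of 1 2] cycle_enum_eq_iff[OF f(1), of 1 0]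
        cycle_enum_eq_iff[OF f(1), of 2 0] f(2) by auto
    moreover have "x \<in> nbs G (f 1)" "x \<in> nbs G (f 2)" "{f 1, f 2} \<subseteq> nbs G x"
      using calculation(1) nbs_sym[of x] by blast+
    ultimately show ?thesis
      using 3 unfolding A by (intro exI[of _ "{{f 1, f 2}}"]) auto
  next
    case 4
    then obtain f where f: "cycle_enum G A 4 f" "f 0 = x" using cycle_block[OF assms(1)] by auto
    have A: "A = {x, f 1, f 2, f 3}"
      using cycle_enum_image[OF f(1)] f(2) by (auto simp: lessThan_nat_numeral lessThan_Suc)
    have "nbs G x \<inter> A = {f 1, f 3}" "nbs G (f 2) \<inter> A = {f 3, f 1}"
      using cycle_enum_nbs[OF f(1), of 0] cycle_enum_nbs[OF f(1), of 2] f(2)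
      by (simp_all add: numeral_eq_Suc)
    moreover have "f 1 \<noteq> f 3" "f 1 \<noteq> x" "f 3 \<noteq> x"
      using cycle_enum_eq_iff[OF f(1), of 1 3] cycle_enum_eq_iff[OF f(1), of 1 0]
        cycle_enum_eq_iff[OF f(1), of 3 0] f(2) by auto
    moreover have "x \<in> nbs G (f 1)" "x \<in> nbs G (f 3)" using calculation(1) nbs_sym[of x] by blast+
    moreover have "{f 1, f 3} \<subseteq> nbs G x" "{f 1, f 3} \<subseteq> nbs G (f 2)" using calculation(1,2) by blast+
    ultimately show ?thesis
      using 4 \<open>f 1 \<noteq> f 3\<close> \<open>f 1 \<noteq> x\<close> \<open>f 3 \<noteq> x\<close>
      unfolding A by (intro exI[of _ "{{f 1, f 3}}"]) auto
  next
    case 5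
    then obtain f where f: "cycle_enum G A 5 f" "f 0 = x" using cycle_block[OF assms(1)] by auto
    have A: "A = {x, f 1, f 2, f 3, f 4}"
      using cycle_enum_image[OF f(1)] f(2) by (auto simp: lessThan_nat_numeral lessThan_Suc)
    have "nbs G x \<inter> A = {f 1, f 4}" "nbs G (f 2) \<inter> A = {f 3, f 1}" "nbs G (f 3) \<inter> A = {f 4, f 2}"
      using cycle_enum_nbs[OF f(1), of 0] cycle_enum_nbs[OF f(1), of 2]
        cycle_enum_nbs[OF f(1), of 3] f(2)
      by (simp_all add: numeral_eq_Suc)
    then have nb: "f 1 \<in> nbs G x" "f 4 \<in> nbs G x" "{f 1, f 3} \<subseteq> nbs G (f 2)" "{f 2, f 4} \<subseteq> nbs G (f 3)"
      by blast+
    then have "x \<in> nbs G (f 1)" "x \<in> nbs G (f 4)" using nbs_sym by blast+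
    note nb = this nb(3,4)
    have ne: "f i \<noteq> f j" if "i < 5" "j < 5" "i \<noteq> j" for i j using that cycle_enum_eq_iff[OF f(1)] by blast
    have "f i \<noteq> x" if "0 < i" "i < 5" for i using ne[of i 0] f(2) that by auto
    \<comment> \<open>The first pair serves \<open>f 2\<close>, the second \<open>f 3\<close>, while
      \<open>f 1\<close> and \<open>f 4\<close> are neighbours of \<open>x\<close>. Both neighbours
      of \<open>x\<close> are used up in different pairs, so a 5-cycle does not help
      \<open>x\<close>.\<close>
    then have "\<forall>p \<in> {{f 1, f 3}, {f 2, f 4}}. card p = 2 \<and> p \<subseteq> A - {x}"
      using ne[of 1 3] ne[of 2 4] by (auto simp: A)
    moreover have "disjoint {{f 1, f 3}, {f 2, f 4}}"
      using ne[of 1 2] ne[of 1 4] ne[of 3 2] ne[of 3 4] by (auto simp: disjoint_def)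
    ultimately show ?thesis
      using 5 nb by (intro exI[of _ "{{f 1, f 3}, {f 2, f 4}}"]) (auto simp: A)
  qed
qed

end

section \<open>Pairing strategies and their extension over 4-cycles\<close>

text \<open>After Dominator has selected \<open>X\<close>, he wins by answering in every pair of \<open>P\<close> that Staller
  touches.\<close>

definition pairing_dominating :: "('a, 'b) pre_digraph \<Rightarrow> 'a set \<Rightarrow> 'a set set \<Rightarrow> bool" where
  "pairing_dominating G X P \<longleftrightarrow> disjoint P \<and> (\<forall>p \<in> P. card p = 2 \<and> p \<subseteq> verts G - X) \<and>
     (\<forall>v \<in> verts G. nbs G v \<inter> X \<noteq> {} \<or> (\<exists>p \<in> P. p \<subseteq> nbs G v))"

lemma (in graph) pairing_dominating_wins:
  assumes "pairing_dominating G X P"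
  shows "dwin (nbhds G) Staller {} (verts G - X)"
proof (rule dwin_pairing[where P = P])
  fix e assume "e \<in> nbhds G"
  then obtain v where v: "v \<in> verts G" "e = nbs G v" by blast
  then have "e \<inter> X \<noteq> {} \<or> (\<exists>p \<in> P. p \<subseteq> e)" using assms by (auto simp: pairing_dominating_def)
  then show "\<not> e \<subseteq> {} \<union> (verts G - X) \<or> (\<exists>p \<in> P. p \<subseteq> verts G - X \<and> p \<subseteq> e)"
  proof
    assume "\<exists>p \<in> P. p \<subseteq> e"
    then show ?thesis using assms by (auto simp: pairing_dominating_def)
  qed auto
qed (use assms in \<open>auto simp: pairing_dominating_def\<close>)

lemma disjoint_UN:
  assumes "disjoint \<A>" "\<And>A. A \<in> \<A> \<Longrightarrow> disjoint (Q A)"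
    and "\<And>A p. A \<in> \<A> \<Longrightarrow> p \<in> Q A \<Longrightarrow> p \<subseteq> A"
  shows "disjoint (\<Union>A \<in> \<A>. Q A)"
proof (rule disjointI)
  fix p q assume "p \<in> (\<Union>A \<in> \<A>. Q A)" "q \<in> (\<Union>A \<in> \<A>. Q A)" "p \<noteq> q"
  then obtain A B where AB: "A \<in> \<A>" "p \<in> Q A" "B \<in> \<A>" "q \<in> Q B" by blast
  show "p \<inter> q = {}"
  proof (cases "A = B")
    case True
    then show ?thesis using disjointD[OF assms(2)] AB \<open>p \<noteq> q\<close> by blast
  next
    case False
    then have "A \<inter> B = {}" using disjointD[OF assms(1)] AB by blast
    then show ?thesis using assms(3) AB by blast
  qed
qed

text \<open>Blocks meet only in \<open>x\<close>, so their pairs can be united. It remains to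
  dominate \<open>x\<close>: by the pair of a 3- or 4-cycle, or by a new pair of two leaves.\<close>

lemma (in star_graph) star_pairing:
  assumes size: "\<And>A. vblock G A \<Longrightarrow> card A \<le> 5"
    and dom: "(\<exists>A. vblock G A \<and> (card A = 3 \<or> card A = 4)) \<or>
      (\<exists>A B. vblock G A \<and> vblock G B \<and> A \<noteq> B \<and> card A = 2 \<and> card B = 2)"
  shows "\<exists>P. pairing_dominating G {x} P"
proof -
  have "\<forall>A \<in> Collect (vblock G). \<exists>Q. disjoint Q \<and> (\<forall>p \<in> Q. card p = 2 \<and> p \<subseteq> A - {x}) \<and>
    (\<forall>v \<in> A - {x}. x \<in> nbs G v \<or> (\<exists>p \<in> Q. p \<subseteq> nbs G v)) \<and>
    (card A = 3 \<or> card A = 4 \<longrightarrow> (\<exists>p \<in> Q. p \<subseteq> nbs G x)) \<and> (card A = 2 \<longrightarrow> Q = {})"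
    using block_pairs size by blast
  from bchoice[OF this] obtain Q where "\<forall>A \<in> Collect (vblock G). disjoint (Q A) \<and>
    (\<forall>p \<in> Q A. card p = 2 \<and> p \<subseteq> A - {x}) \<and>
    (\<forall>v \<in> A - {x}. x \<in> nbs G v \<or> (\<exists>p \<in> Q A. p \<subseteq> nbs G v)) \<and>
    (card A = 3 \<or> card A = 4 \<longrightarrow> (\<exists>p \<in> Q A. p \<subseteq> nbs G x)) \<and> (card A = 2 \<longrightarrow> Q A = {})" ..
  then have Q: "\<And>A. vblock G A \<Longrightarrow> disjoint (Q A)"
    "\<And>A p. vblock G A \<Longrightarrow> p \<in> Q A \<Longrightarrow> card p = 2 \<and> p \<subseteq> A - {x}"
    "\<And>A v. vblock G A \<Longrightarrow> v \<in> A - {x} \<Longrightarrow> x \<in> nbs G v \<or> (\<exists>p \<in> Q A. p \<subseteq> nbs G v)"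
    "\<And>A. vblock G A \<Longrightarrow> card A = 3 \<or> card A = 4 \<Longrightarrow> \<exists>p \<in> Q A. p \<subseteq> nbs G x"
    "\<And>A. vblock G A \<Longrightarrow> card A = 2 \<Longrightarrow> Q A = {}"
    by (simp_all only: mem_Collect_eq Ball_def)
  define P where "P = (\<Union>A \<in> Collect (vblock G). Q A)"
  have dis: "disjoint P"
  proof (rule disjointI)
    fix p q assume "p \<in> P" "q \<in> P" "p \<noteq> q"
    then obtain A B where AB: "vblock G A" "p \<in> Q A" "vblock G B" "q \<in> Q B" by (auto simp: P_def)
    show "p \<inter> q = {}"
    proof (cases "A = B")
      case True
      then show ?thesis using disjointD[OF Q(1)] AB \<open>p \<noteq> q\<close> by blast
    next
      case False
      have "v = x" if "v \<in> p \<inter> q" for v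
        using block_Int[OF AB(1,3) False] that Q(2)[OF AB(1,2)] Q(2)[OF AB(3,4)] by blast
      then show ?thesis using Q(2)[OF AB(1,2)] by blast
    qed
  qed
  have P: "card p = 2 \<and> p \<subseteq> verts G - {x}" if p: "p \<in> P" for p
  proof -
    obtain A where A: "vblock G A" "p \<in> Q A" using p by (auto simp: P_def)
    then have "A \<subseteq> verts G" by (simp add: vblock_def nsep_def)
    then show ?thesis using Q(2)[OF A] by blast
  qed
  have others: "nbs G v \<inter> {x} \<noteq> {} \<or> (\<exists>p \<in> P. p \<subseteq> nbs G v)" if v: "v \<in> verts G" "v \<noteq> x" for v
  proof -
    obtain A where "vblock G A" "v \<in> A" using ex_block[OF v(1)] .
    then show ?thesis using Q(3)[of A v] v(2) unfolding P_def by blast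
  qed
  from dom show ?thesis
  proof (elim disjE exE conjE)
    fix A assume "vblock G A" "card A = 3"
    then have "\<exists>p \<in> P. p \<subseteq> nbs G x" using Q(4) unfolding P_def by blast
    then have "pairing_dominating G {x} P" using dis P others unfolding pairing_dominating_def by metis
    then show ?thesis ..
  next
    fix A assume "vblock G A" "card A = 4"
    then have "\<exists>p \<in> P. p \<subseteq> nbs G x" using Q(4) unfolding P_def by blast
    then have "pairing_dominating G {x} P" using dis P others unfolding pairing_dominating_def by metis
    then show ?thesis ..
  next
    fix A B assume AB: "vblock G A" "vblock G B" "A \<noteq> B" "card A = 2" "card B = 2"
    obtain a where a: "A = {x, a}" "a \<noteq> x" "a \<in> nbs G x" using pair_block AB by metis
    obtain b where b: "B = {x, b}" "b \<noteq> x" "b \<in> nbs G x" using pair_block AB by metis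
    have "a \<noteq> b" using a b AB(3) by blast
    \<comment> \<open>A leaf is in no pair so far, since its \<open>K\<^sub>2\<close> block
      contributes none.\<close>
    have free: "l \<notin> p" if l: "vblock G C" "card C = 2" "C = {x, l}" "l \<noteq> x" and "p \<in> P" for C l p
    proof
      assume "l \<in> p"
      obtain D where D: "vblock G D" "p \<in> Q D" using \<open>p \<in> P\<close> by (auto simp: P_def)
      have "D = C" using block_Int[OF D(1) l(1), of l] Q(2)[OF D] l \<open>l \<in> p\<close> by blast
      then show False using Q(5)[OF l(1,2)] D by simp
    qed
    have "disjoint (insert {a, b} P)"
      using dis free[OF AB(1,4) a(1,2)] free[OF AB(2,5) b(1,2)] by (auto simp: disjoint_def)
    moreover have "card {a, b} = 2" "{a, b} \<subseteq> verts G - {x}" "{a, b} \<subseteq> nbs G x"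
      using a b \<open>a \<noteq> b\<close> nbs_verts by auto
    ultimately have "pairing_dominating G {x} (insert {a, b} P)"
      using P others unfolding pairing_dominating_def by (metis insert_iff)
    then show ?thesis ..
  qed
qed

text \<open>The pairs are the opposite vertices: each pair consists of the cycle neighbours of both
  vertices in the other. This holds however \<open>A\<close> is attached, so it serves removed
  end-blocks and parts of a partition alike.\<close>

lemma C4_pairs:
  assumes "cycle_graph 4 (G \<restriction> A)"
  shows "\<exists>Q. disjoint Q \<and> (\<forall>p \<in> Q. card p = 2 \<and> p \<subseteq> A) \<and> (\<forall>v \<in> A. \<exists>p \<in> Q. p \<subseteq> nbs G v)"
proof -
  obtain f where f: "cycle_enum G A 4 f" using cycle_graph_induceE[OF assms] .
  have A: "A = {f 0, f 1, f 2, f 3}"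
    using cycle_enum_image[OF f] by (auto simp: lessThan_nat_numeral lessThan_Suc)
  have "nbs G (f 0) \<inter> A = {f 1, f 3}" "nbs G (f 1) \<inter> A = {f 2, f 0}"
    "nbs G (f 2) \<inter> A = {f 3, f 1}" "nbs G (f 3) \<inter> A = {f 0, f 2}"
    using cycle_enum_nbs[OF f, of 0] cycle_enum_nbs[OF f, of 1] cycle_enum_nbs[OF f, of 2]
      cycle_enum_nbs[OF f, of 3] by (simp_all add: numeral_eq_Suc)
  then have "{f 1, f 3} \<subseteq> nbs G (f 0)" "{f 0, f 2} \<subseteq> nbs G (f 1)"
    "{f 1, f 3} \<subseteq> nbs G (f 2)" "{f 0, f 2} \<subseteq> nbs G (f 3)" by blast+
  moreover have ne: "f i \<noteq> f j" if "i < 4" "j < 4" "i \<noteq> j" for i j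
    using that cycle_enum_eq_iff[OF f] by blast
  have "disjoint {{f 0, f 2}, {f 1, f 3}}"
    using ne[of 0 1] ne[of 0 3] ne[of 2 1] ne[of 2 3] by (auto simp: disjoint_def)
  ultimately show ?thesis
    using ne[of 0 2] ne[of 1 3] by (intro exI[of _ "{{f 0, f 2}, {f 1, f 3}}"]) (auto simp: A)
qed

text \<open>Neighbourhoods only grow from \<open>G'\<close> to \<open>G\<close>, and the pairs on
  the restored 4-cycle are disjoint from the old ones.\<close>

lemma pairing_remove_end_C4:
  assumes "graph G" "remove_end_C4 G G'" "pairing_dominating G' X P" "X \<subseteq> verts G'"
  shows "\<exists>P. pairing_dominating G X P"
proof -
  obtain A f where A: "pendant G A (f (0 :: nat))" "cycle_graph 4 (G \<restriction> A)" "G' = G \<restriction> (verts G - A)"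
    using remove_end_C4E[OF assms(1,2)] by metis
  obtain Q where "disjoint Q \<and> (\<forall>p \<in> Q. card p = 2 \<and> p \<subseteq> A) \<and> (\<forall>v \<in> A. \<exists>p \<in> Q. p \<subseteq> nbs G v)"
    using C4_pairs[OF A(2)] ..
  then have Q: "disjoint Q" "\<And>p. p \<in> Q \<Longrightarrow> card p = 2 \<and> p \<subseteq> A"
    "\<And>v. v \<in> A \<Longrightarrow> \<exists>p \<in> Q. p \<subseteq> nbs G v" by blast+
  have AG: "A \<subseteq> verts G" using A(1) by (simp add: pendant_def)
  have P: "disjoint P" "\<And>p. p \<in> P \<Longrightarrow> card p = 2 \<and> p \<subseteq> verts G - A - X"
    "\<And>v. v \<in> verts G - A \<Longrightarrow> nbs G' v \<inter> X \<noteq> {} \<or> (\<exists>p \<in> P. p \<subseteq> nbs G' v)"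
    using assms(3) A(3) by (auto simp: pairing_dominating_def)
  have X: "X \<subseteq> verts G - A" using assms(4) A(3) by simp
  have nb: "nbs G' v \<subseteq> nbs G v" for v using A(3) by (auto simp: nbs_induce split: if_splits)
  have "disjoint (P \<union> Q)"
  proof (rule disjointI)
    fix p q assume "p \<in> P \<union> Q" "q \<in> P \<union> Q" "p \<noteq> q"
    then show "p \<inter> q = {}" using P(2) Q(2) disjointD[OF P(1)] disjointD[OF Q(1)] by blast
  qed
  moreover have "card p = 2 \<and> p \<subseteq> verts G - X" if "p \<in> P \<union> Q" for p
    using that P(2) Q(2) AG X by blast
  moreover have "nbs G v \<inter> X \<noteq> {} \<or> (\<exists>p \<in> P \<union> Q. p \<subseteq> nbs G v)" if "v \<in> verts G" for v
    using that P(3)[of v] Q(3)[of v] nb[of v] by (cases "v \<in> A") blast+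
  ultimately show ?thesis unfolding pairing_dominating_def by blast
qed

lemma pairing_C4_partition:
  assumes "graph G" "partition_on (verts G) P" "\<And>A. A \<in> P \<Longrightarrow> cycle_graph 4 (G \<restriction> A)"
  shows "\<exists>Q. pairing_dominating G {} Q"
proof -
  have "\<forall>A \<in> P. \<exists>Q. disjoint Q \<and> (\<forall>p \<in> Q. card p = 2 \<and> p \<subseteq> A) \<and> (\<forall>v \<in> A. \<exists>p \<in> Q. p \<subseteq> nbs G v)"
    using C4_pairs assms(3) by blast
  from bchoice[OF this] obtain Q where "\<forall>A \<in> P. disjoint (Q A) \<and>
    (\<forall>p \<in> Q A. card p = 2 \<and> p \<subseteq> A) \<and> (\<forall>v \<in> A. \<exists>p \<in> Q A. p \<subseteq> nbs G v)" ..
  then have Q: "\<And>A. A \<in> P \<Longrightarrow> disjoint (Q A)"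
    "\<And>A p. A \<in> P \<Longrightarrow> p \<in> Q A \<Longrightarrow> card p = 2 \<and> p \<subseteq> A"
    "\<And>A v. A \<in> P \<Longrightarrow> v \<in> A \<Longrightarrow> \<exists>p \<in> Q A. p \<subseteq> nbs G v" by blast+
  have P: "disjoint P" "\<Union>P = verts G" using assms(2) by (auto simp: partition_on_def)
  have "disjoint (\<Union>A \<in> P. Q A)" by (rule disjoint_UN[OF P(1)]) (simp_all add: Q)
  moreover have "\<forall>p \<in> (\<Union>A \<in> P. Q A). card p = 2 \<and> p \<subseteq> verts G - {}"
    using Q(2) P(2) by blast
  moreover have "\<forall>v \<in> verts G. nbs G v \<inter> {} \<noteq> {} \<or> (\<exists>p \<in> (\<Union>A \<in> P. Q A). p \<subseteq> nbs G v)"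
  proof (intro ballI disjI2)
    fix v assume "v \<in> verts G"
    then obtain A where "A \<in> P" "v \<in> A" using P(2) by blast
    then show "\<exists>p \<in> (\<Union>A \<in> P. Q A). p \<subseteq> nbs G v" using Q(3)[of A v] by blast
  qed
  ultimately have "pairing_dominating G {} (\<Union>A \<in> P. Q A)"
    unfolding pairing_dominating_def by (intro conjI)
  then show ?thesis ..
qed

section \<open>Outcomes of cacti\<close>

context graph begin

lemma vblocks_finite: "finite {A. vblock G A}"
  by (rule finite_subset[of _ "Pow (verts G)"]) (auto simp: vblock_def nsep_def)

lemma blocks_eq_image: "{B. block G B} = (\<lambda>A. G \<restriction> A) ` {A. vblock G A}"
  by (auto simp: block_iff)

lemma card_blocks: "card {B. block G B} = card {A. vblock G A}"
  unfolding blocks_eq_image by (intro card_image inj_onI) (metis induce_subgraph_verts)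

lemma star_cactus_iff:
  "star_cactus G \<longleftrightarrow> cactus G \<and> (\<exists>c \<in> verts G. \<forall>A. vblock G A \<longrightarrow> c \<in> A)"
  unfolding star_cactus_def block_iff by (metis induce_subgraph_verts)

lemma induce_verts: "G \<restriction> verts G = G"
  by (rule pre_digraph.equality) auto

text \<open>A cycle has a nonseparable vertex set even as a non-induced subgraph. With
  \<open>cactoid_vblock\<close>, conditions on cycles thus become conditions on block sizes.\<close>

lemma contains_cycleE:
  assumes "contains_cycle G n"
  obtains A where "nsep G A" "card A = n" "3 \<le> n"
proof -
  obtain C where C: "subgraph C G" "cycle_graph n C" using assms by (auto simp: contains_cycle_def)
  obtain f where f: "cycle_enum C (verts C) n f" using cycle_enum_verts[OF C(2)] by blast
  have "graph C" "3 \<le> n" using C(2) by (auto simp: cycle_graph_def)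
  then have "nsep C (verts C)" using graph.nsep_cycle_enum f by blast
  then show ?thesis using that nsep_subgraph[OF C(1)] cycle_enum_card[OF f] \<open>3 \<le> n\<close> by blast
qed

lemma contains_cycleI: "A \<subseteq> verts G \<Longrightarrow> cycle_graph n (G \<restriction> A) \<Longrightarrow> contains_cycle G n"
  unfolding contains_cycle_def using subgraph_induceI by blast

end

lemma (in star_graph) cactus_if_large_block:
  assumes "\<exists>A. vblock G A \<and> 2 \<le> card A"
  shows "cactus G"
proof -
  obtain A where A: "vblock G A" "2 \<le> card A" using assms by blast
  then have "card A \<le> card (verts G)" by (intro card_mono) (auto simp: vblock_def nsep_def)
  then show ?thesis using A(2) by (intro cactoid_imp_cactus cactoid conn) auto
qed

text \<open>A single block must be a triangle or a 4-cycle, because one \<open>K\<^sub>2\<close> or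
  5-cycle cannot secure \<open>x\<close>. The 4-cycle is the case in which one more removal empties
  the graph.\<close>

lemma (in star_graph) star_cases:
  assumes win: "dwin (nbhds G) Staller {} (verts G - {x})"
  shows "N_star_cactus G \<or> remove_end_C4 G (G \<restriction> {})"
proof -
  note dom = centre_dominated[OF win]
  have cactus: "cactus G"
  proof (rule cactus_if_large_block)
    show "\<exists>A. vblock G A \<and> 2 \<le> card A"
      using dom by (metis le_refl numeral_le_iff semiring_norm(68,69,71,72))
  qed
  show ?thesis
  proof (cases "\<exists>A B. vblock G A \<and> vblock G B \<and> A \<noteq> B")
    case False
    obtain A where A: "vblock G A" "card A = 3 \<or> card A = 4" using dom False by blast
    have "verts G \<subseteq> A"
    proof
      fix v assume "v \<in> verts G"
      then obtain B where "vblock G B" "v \<in> B" by (rule ex_block)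
      then show "v \<in> A" using False A(1) by blast
    qed
    then have V: "A = verts G" using A(1) by (auto simp: vblock_def nsep_def)
    have "3 \<le> card A" using A(2) by auto
    then have cyc: "cycle_graph (card A) G"
      using cycle_block[OF A(1)] V induce_verts by metis
    from A(2) show ?thesis
    proof
      assume "card A = 3"
      then show ?thesis using cyc cactus by (simp add: N_star_cactus_def)
    next
      assume "card A = 4"
      then have "remove_end_C4 G (G \<restriction> (verts G - A))"
        using cyc block_pendant[OF A(1)] A(1) V induce_verts
        by (intro remove_end_C4I[OF graph_axioms]) auto
      then show ?thesis using V by simp
    qed
  next
    case True
    then obtain A B where AB: "vblock G A" "vblock G B" "A \<noteq> B" by blast
    have "card {A, B} \<le> card {A. vblock G A}"
      using AB by (intro card_mono vblocks_finite) auto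
    then have "2 \<le> card {B. block G B}" using AB(3) by (simp add: card_blocks)
    moreover have "star_cactus G"
      using cactus centre centre_verts star_cactus_iff by blast
    moreover have "n \<le> 5" if n: "contains_cycle G n" for n
    proof -
      obtain C where "nsep G C" "card C = n" "3 \<le> n" using contains_cycleE[OF n] .
      then show ?thesis using block_size[OF win] cactoid_vblock[OF cactoid] by metis
    qed
    moreover have "contains_cycle G 3 \<or> contains_cycle G 4 \<or>
       (\<exists>B B'. block G B \<and> block G B' \<and> B \<noteq> B' \<and> K\<^bsub>2\<^esub> B \<and> K\<^bsub>2\<^esub> B')"
      using dom
    proof (elim disjE exE conjE)
      fix C assume C: "vblock G C" "card C = 3"
      then have "cycle_graph 3 (G \<restriction> C)" using cycle_block[OF C(1)] by auto
      moreover have "C \<subseteq> verts G" using C(1) by (simp add: vblock_def nsep_def)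
      ultimately show ?thesis using contains_cycleI by blast
    next
      fix C assume C: "vblock G C" "card C = 4"
      then have "cycle_graph 4 (G \<restriction> C)" using cycle_block[OF C(1)] by auto
      moreover have "C \<subseteq> verts G" using C(1) by (simp add: vblock_def nsep_def)
      ultimately show ?thesis using contains_cycleI by blast
    next
      fix C D assume CD: "vblock G C" "vblock G D" "C \<noteq> D" "card C = 2" "card D = 2"
      then have "block G (G \<restriction> C)" "block G (G \<restriction> D)" "K\<^bsub>2\<^esub> (G \<restriction> C)" "K\<^bsub>2\<^esub> (G \<restriction> D)"
        using block_iff nsep_K2 unfolding vblock_def by blast+
      moreover have "G \<restriction> C \<noteq> G \<restriction> D" using CD(3) induce_subgraph_verts by metis
      ultimately show ?thesis by blast
    qed
    ultimately show ?thesis using cactus by (simp add: N_star_cactus_def)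
  qed
qed

text \<open>Restates the definition through block sizes around a centre. The triangle has a single
  block, so its centre is arbitrary and it accounts for the last alternative.\<close>

lemma N_star_cactus_star_graph:
  assumes "N_star_cactus G"
  obtains x where "star_graph G x" "\<And>A. vblock G A \<Longrightarrow> card A \<le> 5"
    and "(\<exists>A. vblock G A \<and> (card A = 3 \<or> card A = 4)) \<or>
      (\<exists>A B. vblock G A \<and> vblock G B \<and> A \<noteq> B \<and> card A = 2 \<and> card B = 2)"
    and "(\<exists>A B. vblock G A \<and> vblock G B \<and> A \<noteq> B) \<or> card (verts G) = 3 \<and> vblock G (verts G)"
proof -
  have cactus: "cactus G" using assms by (simp add: N_star_cactus_def)
  interpret graph G using cactus by (simp add: cactus_def)
  have star: "star_graph G x" if "x \<in> verts G" "\<And>A. vblock G A \<Longrightarrow> x \<in> A" for x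
    using that cactus cactus_imp_cactoid[OF cactus] connected_iff
    by unfold_locales (auto simp: cactus_def)
  consider "cycle_graph 3 G" | "star_cactus G" "2 \<le> card {B. block G B}"
    "\<And>n. contains_cycle G n \<Longrightarrow> n \<le> 5" "contains_cycle G 3 \<or> contains_cycle G 4 \<or>
       (\<exists>B B'. block G B \<and> block G B' \<and> B \<noteq> B' \<and> K\<^bsub>2\<^esub> B \<and> K\<^bsub>2\<^esub> B')"
    using assms unfolding N_star_cactus_def by blast
  then show ?thesis
  proof cases
    case 1
    then obtain f where f: "cycle_enum G (verts G) 3 f" using cycle_enum_verts by blast
    have ns: "nsep G (verts G)" using nsep_cycle_enum[OF f] by blast
    have V: "A = verts G" if "vblock G A" for A
      using that ns unfolding vblock_def nsep_def by blast
    obtain A where "vblock G A" using ex_vblock[OF ns] .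
    then have vb: "vblock G (verts G)" using V by blast
    have card: "card (verts G) = 3" by (rule cycle_enum_card[OF f])
    show ?thesis
    proof (rule that[of "f 0"])
      show "star_graph G (f 0)"
      proof (rule star)
        show "f 0 \<in> verts G" using cycle_enum_mem[OF f] by simp
        then show "f 0 \<in> A" if "vblock G A" for A using V[OF that] by simp
      qed
      show "card A \<le> 5" if "vblock G A" for A using V[OF that] card by simp
    qed (use vb card in blast)+
  next
    case 2
    obtain x where x: "x \<in> verts G" "\<And>A. vblock G A \<Longrightarrow> x \<in> A"
      using 2(1) star_cactus_iff by blast
    interpret star_graph G x using star x by blast
    show ?thesis
    proof (rule that[of x])
      show "star_graph G x" ..
      show "card A \<le> 5" if A: "vblock G A" for A
      proof (rule ccontr)
        assume "\<not> card A \<le> 5"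
        then have "3 \<le> card A" by simp
        then have "cycle_graph (card A) (G \<restriction> A)" using cycle_block[OF A] by blast
        moreover have "A \<subseteq> verts G" using A by (simp add: vblock_def nsep_def)
        ultimately have "contains_cycle G (card A)" by (intro contains_cycleI)
        then show False using 2(3) \<open>\<not> card A \<le> 5\<close> by blast
      qed
      have cyc: "\<exists>A. vblock G A \<and> card A = n" if "contains_cycle G n" for n
        using contains_cycleE[OF that] cactoid_vblock[OF cactoid] by metis
      from 2(4) show "(\<exists>A. vblock G A \<and> (card A = 3 \<or> card A = 4)) \<or>
          (\<exists>A B. vblock G A \<and> vblock G B \<and> A \<noteq> B \<and> card A = 2 \<and> card B = 2)"
      proof (elim disjE exE conjE)
        fix B B' assume B: "block G B" "block G B'" "B \<noteq> B'" "K\<^bsub>2\<^esub> B" "K\<^bsub>2\<^esub> B'"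
        then obtain C D where "vblock G C" "B = G \<restriction> C" "vblock G D" "B' = G \<restriction> D"
          using block_iff by metis
        then show ?thesis using B(3-5) unfolding complete_digraph_def
          by (intro disjI2 exI[of _ C] exI[of _ D]) auto
      qed (use cyc in blast)+
      have "card {A. vblock G A} \<noteq> 0" "card {A. vblock G A} \<noteq> 1"
        using 2(2) unfolding card_blocks by linarith+
      then have "{A. vblock G A} \<noteq> {}" "\<And>A. {A. vblock G A} \<noteq> {A}" by (metis card.empty, metis is_singletonI is_singleton_altdef)
      then show "(\<exists>A B. vblock G A \<and> vblock G B \<and> A \<noteq> B) \<or> card (verts G) = 3 \<and> vblock G (verts G)"
        by blast
    qed
  qed
qed

lemma N_star_cactus_Dominator:
  assumes "N_star_cactus G"
  shows "\<exists>x P. x \<in> verts G \<and> pairing_dominating G {x} P"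
proof -
  obtain x where x: "star_graph G x" "\<And>A. vblock G A \<Longrightarrow> card A \<le> 5"
    "(\<exists>A. vblock G A \<and> (card A = 3 \<or> card A = 4)) \<or>
      (\<exists>A B. vblock G A \<and> vblock G B \<and> A \<noteq> B \<and> card A = 2 \<and> card B = 2)"
    by (rule N_star_cactus_star_graph[OF assms]) blast
  show ?thesis
    using star_graph.star_pairing[OF x] star_graph.centre_verts[OF x(1)] by blast
qed

text \<open>Two blocks give a fork at the centre, and in the triangle any vertex gives one.\<close>

lemma N_star_cactus_Staller:
  assumes "N_star_cactus G"
  shows "\<not> dwin (nbhds G) Staller {} (verts G)"
proof -
  obtain x where x: "star_graph G x"
    "(\<exists>A B. vblock G A \<and> vblock G B \<and> A \<noteq> B) \<or> card (verts G) = 3 \<and> vblock G (verts G)"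
    by (rule N_star_cactus_star_graph[OF assms]) blast
  interpret star_graph G x by fact
  from x(2) show ?thesis
  proof
    assume "\<exists>A B. vblock G A \<and> vblock G B \<and> A \<noteq> B"
    then show ?thesis using Staller_wins_two_blocks by blast
  next
    assume V: "card (verts G) = 3 \<and> vblock G (verts G)"
    then obtain f where f: "cycle_enum G (verts G) 3 f" "f 0 = x" "pendant G (verts G) (f 0)"
      using cycle_block[of "verts G"] by auto
    have nb: "nbs G (f 1) = {f 2, f 0}" "nbs G (f 2) = {f 0, f 1}"
      using pendant_nbs[OF f(1,3), of 1] pendant_nbs[OF f(1,3), of 2] by (simp_all add: numeral_2_eq_2)
    have mem: "f i \<in> verts G" if "i < 3" for i using cycle_enum_mem[OF f(1) that] .
    have ne: "f i \<noteq> f j" if "i < 3" "j < 3" "i \<noteq> j" for i j using that cycle_enum_eq_iff[OF f(1)] by blast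
    show ?thesis
    proof
      assume win: "dwin (nbhds G) Staller {} (verts G)"
      show False
        by (rule dwin_no_double_threat[OF win mem mem mem _ imageI[OF mem] _ imageI[OF mem], of 0 2 1 1 2])
          (use nb ne[of 0 1] ne[of 0 2] ne[of 1 2] in auto)
    qed
  qed
qed

section \<open>Transfer along sequences of removals\<close>

lemma remove_end_C4_graph: "graph G \<Longrightarrow> remove_end_C4 G G' \<Longrightarrow> graph G' \<and> verts G' \<subseteq> verts G"
  unfolding remove_end_C4_def by (auto intro!: graph.graph_induce)

text \<open>Used in contrapositive form: a win of Staller on what remains carries over to the graph
  before the removals.\<close>

lemma remove_end_C4_Staller:
  assumes "remove_end_C4\<^sup>*\<^sup>* G H" "graph G" "dwin (nbhds G) Staller {} (verts G)"
  shows "dwin (nbhds H) Staller {} (verts H)"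
  using assms
proof (induction rule: converse_rtranclp_induct)
  case (step G G')
  obtain A f where A: "cycle_enum G A 4 f" "pendant G A (f 0)" "G' = G \<restriction> (verts G - A)"
    using remove_end_C4E[OF step.prems(1) step.hyps(1)] .
  have "dwin (nbhds G') Staller {} (verts G')"
    using dwin_remove_end_C4[OF step.prems(1) A(1,2), of "{}"] step.prems(2) A(3) by simp
  then show ?case using step remove_end_C4_graph by blast
qed

lemma remove_end_C4_pairing:
  assumes "remove_end_C4\<^sup>*\<^sup>* G H" "graph G" "pairing_dominating H X P" "X \<subseteq> verts H"
  shows "X \<subseteq> verts G \<and> (\<exists>P. pairing_dominating G X P)"
  using assms
proof (induction rule: converse_rtranclp_induct)
  case (step G G')
  then have "graph G'" "verts G' \<subseteq> verts G" using remove_end_C4_graph by blast+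
  then obtain P' where "pairing_dominating G' X P'" "X \<subseteq> verts G'" using step by blast
  then show ?case
    using pairing_remove_end_C4[OF step.prems(1) step.hyps(1)] \<open>verts G' \<subseteq> verts G\<close> by blast
qed blast

text \<open>The parts are the removed 4-cycles. They are induced in the original graph because every
  later graph is an induced subgraph of it.\<close>

lemma remove_end_C4_partition:
  assumes "remove_end_C4\<^sup>*\<^sup>* G H" "graph G" "verts H = {}"
  shows "\<exists>P. partition_on (verts G) P \<and> (\<forall>A \<in> P. card A = 4 \<and> cycle_graph 4 (G \<restriction> A))"
  using assms
proof (induction rule: converse_rtranclp_induct)
  case base
  then show ?case by (intro exI[of _ "{}"]) (simp add: partition_on_def)
next
  case (step G G')
  obtain A f where A: "cycle_enum G A 4 f" "pendant G A (f 0)" "cycle_graph 4 (G \<restriction> A)"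
    "G' = G \<restriction> (verts G - A)" using remove_end_C4E[OF step.prems(1) step.hyps(1)] .
  obtain P where P: "partition_on (verts G - A) P" "\<And>B. B \<in> P \<Longrightarrow> card B = 4 \<and> cycle_graph 4 (G' \<restriction> B)"
    using step remove_end_C4_graph A(4) by fastforce
  have "A \<subseteq> verts G" "A \<noteq> {}" using A(2) by (auto simp: pendant_def)
  then have "partition_on (verts G) (insert A P)"
    using P(1) by (auto simp: partition_on_def disjoint_def)
  moreover have "cycle_graph 4 (G \<restriction> B)" if "B \<in> P" for B
  proof -
    have "B \<subseteq> verts G - A" using P(1) that by (auto simp: partition_on_def)
    then show ?thesis using P(2)[OF that] unfolding A(4) by (simp add: induce_induce)
  qed
  ultimately show ?case using P(2) A(3) cycle_enum_card[OF A(1)] by (intro exI[of _ "insert A P"]) auto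
qed

text \<open>As long as Dominator owns nothing, the vertex set of a nonempty graph is itself
  separated, so the reduction can only end at the empty graph. The converse is the pairing
  strategy.\<close>

lemma Staller_start_iff:
  assumes "cactoid G"
  shows "dwin (nbhds G) Staller {} (verts G) \<longleftrightarrow>
    (\<exists>P. partition_on (verts G) P \<and> (\<forall>A \<in> P. card A = 4 \<and> cycle_graph 4 (G \<restriction> A)))"
proof
  have G: "graph G" using assms by (simp add: cactoid_def)
  assume "dwin (nbhds G) Staller {} (verts G)"
  then obtain H where H: "remove_end_C4\<^sup>*\<^sup>* G H" "cactoid H" "\<forall>K. \<not> separated H {} K"
    using reduce_end_C4[OF assms, of "{}"] by auto
  have "graph H" using H(2) by (simp add: cactoid_def)
  have "verts H = {}"
  proof (rule ccontr)
    assume "verts H \<noteq> {}"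
    then have "separated H {} (verts H)"
      using graph.nbs_verts[OF \<open>graph H\<close>] by (intro separatedI) auto
    then show False using H(3) by blast
  qed
  then show "\<exists>P. partition_on (verts G) P \<and> (\<forall>A \<in> P. card A = 4 \<and> cycle_graph 4 (G \<restriction> A))"
    using remove_end_C4_partition H(1) G by blast
next
  have G: "graph G" using assms by (simp add: cactoid_def)
  assume "\<exists>P. partition_on (verts G) P \<and> (\<forall>A \<in> P. card A = 4 \<and> cycle_graph 4 (G \<restriction> A))"
  then obtain Q where "pairing_dominating G {} Q" using pairing_C4_partition[OF G] by metis
  then show "dwin (nbhds G) Staller {} (verts G)"
    using graph.pairing_dominating_wins[OF G, of "{}"] by simp
qed

text \<open>The reduction spares Dominator's first vertex \<open>x\<close> and ends in a star graph
  around it. Were that a 4-cycle, the whole of \<open>G\<close> would be partitioned into 4-cycles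
  and Dominator would also win as second player.\<close>

lemma Dominator_start:
  assumes "cactoid G" "dwin (nbhds G) Dominator {} (verts G)" "\<not> dwin (nbhds G) Staller {} (verts G)"
  shows "\<exists>H. remove_end_C4\<^sup>*\<^sup>* G H \<and> N_star_cactus H"
proof -
  have G: "graph G" using assms by (simp add: cactoid_def)
  have "verts G \<noteq> {}" using assms(2,3) by fastforce
  then obtain x where x: "x \<in> verts G" "dwin (nbhds G) Staller {} (verts G - {x})"
    using assms(2) dwin_Dominator_iff by metis
  then obtain H where H: "remove_end_C4\<^sup>*\<^sup>* G H" "cactoid H" "x \<in> verts H"
    "dwin (nbhds H) Staller {} (verts H - {x})" "\<And>K. \<not> separated H {x} K"
    using reduce_end_C4[OF assms(1), of "{x}"] by auto
  interpret H: graph H using H(2) by (simp add: cactoid_def)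
  interpret star_graph H x
    using H H.not_separated_imp_centre[of x] by unfold_locales auto
  from star_cases[OF H(4)] show ?thesis
  proof
    assume "remove_end_C4 H (H \<restriction> {})"
    then have "remove_end_C4\<^sup>*\<^sup>* G (H \<restriction> {})" using H(1) by (rule_tac rtranclp.rtrancl_into_rtrancl)
    then have "dwin (nbhds G) Staller {} (verts G)"
      using remove_end_C4_partition[OF _ G] Staller_start_iff[OF assms(1)] by fastforce
    then show ?thesis using assms(3) by blast
  qed (use H(1) in blast)
qed

lemma N_star_cactus_lift:
  assumes "graph G" "remove_end_C4\<^sup>*\<^sup>* G H" "N_star_cactus H"
  shows "dwin (nbhds G) Dominator {} (verts G)" and "\<not> dwin (nbhds G) Staller {} (verts G)"
proof -
  obtain x P where "x \<in> verts H" "pairing_dominating H {x} P"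
    using N_star_cactus_Dominator[OF assms(3)] by blast
  then obtain P' where "x \<in> verts G" "pairing_dominating G {x} P'"
    using remove_end_C4_pairing[OF assms(2,1), of "{x}"] by blast
  then show "dwin (nbhds G) Dominator {} (verts G)"
    using graph.pairing_dominating_wins[OF assms(1)] by (auto intro: dwin.dominator)
  show "\<not> dwin (nbhds G) Staller {} (verts G)"
    using N_star_cactus_Staller[OF assms(3)] remove_end_C4_Staller[OF assms(2,1)] by blast
qed

theorem theorem5p4:
  fixes G :: "('a, 'b) pre_digraph"
  assumes "cactus G"
    and "2 \<le> card {B. block G B}"
  shows "(graph_D G \<longleftrightarrow>
           (\<exists>P. partition_on (verts G) P \<and> (\<forall>A \<in> P. card A = 4 \<and> cycle_graph 4 (G \<restriction> A))))
       \<and> (graph_N G \<longleftrightarrow> (\<exists>H. remove_end_C4\<^sup>*\<^sup>* G H \<and> N_star_cactus H))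
       \<and> (\<not> (\<exists>P. partition_on (verts G) P \<and> (\<forall>A \<in> P. card A = 4 \<and> cycle_graph 4 (G \<restriction> A)))
          \<and> \<not> (\<exists>H. remove_end_C4\<^sup>*\<^sup>* G H \<and> N_star_cactus H)
          \<longrightarrow> graph_S G)"
proof -
  have cactoid: "cactoid G" using assms(1) by (rule cactus_imp_cactoid)
  then have G: "graph G" by (simp add: cactoid_def)
  let ?D = "dwin (nbhds G) Dominator {} (verts G)" and ?S = "dwin (nbhds G) Staller {} (verts G)"
  \<comment> \<open>This rules out the fourth combination of outcomes and reduces the first claim to
    the game that Staller starts.\<close>
  have "?S \<Longrightarrow> ?D" by (rule dwin_extra_move)
  moreover have "?D \<and> \<not> ?S \<longleftrightarrow> (\<exists>H. remove_end_C4\<^sup>*\<^sup>* G H \<and> N_star_cactus H)"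
    using Dominator_start[OF cactoid] N_star_cactus_lift[OF G] by blast
  moreover have "graph_D G \<longleftrightarrow> ?D \<and> ?S" "graph_S G \<longleftrightarrow> \<not> ?D \<and> \<not> ?S" "graph_N G \<longleftrightarrow> ?D \<and> \<not> ?S"
    by (simp_all add: graph_D_def graph_S_def graph_N_def graph.wins_game_iff[OF G])
  ultimately show ?thesis unfolding Staller_start_iff[OF cactoid, symmetric] by blast
qed

end
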